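(* Let $\Gamma$ be a finitely generated virtually abelian group, given with an exact sequence $0\to\mathbb{Z}^n\to\Gamma\to G\to 1$ with $G$ finite, and let $\mu:G\to \mathrm{GL}(n,\mathbb{Z})$ be its characteristic representation. The following conditions are equivalent: 1. $\Gamma$ admits a polarisable complex structure, i.e. there exists a $\mu$-invariant complex structure $J$ on $\mathbb{R}^n$ which is polarisable with respect to $\mathbb{Z}^n$. 2. The characteristic representation $\mu$ is $\mathrm{SL}_n(\mathbb{Z})$-conjugate to an integral symplectic representation.
   Context: The characteristic representation $\mu$ is the action of $G$ on $\mathbb{Z}^n$ induced by conjugation in $\Gamma$. A complex structure on $\mathbb{R}^n$ is a linear map $J$ with $J^2=-\mathrm{id}$; it is $\mu$-invariant if $\mu(g)J=J\mu(g)$ for all $g\in G$. $J$ is polarisable (with respect to $\mathbb{Z}^n$) if there is $\omega\in\bigwedge^2(\mathbb{R}^n)^*$ such that (1) $\omega(J\cdot,J\cdot)=\omega(\cdot,\cdot)$, (2) the symmetric form $\omega(J\cdot,\cdot)$ is positive definite, (3) $\omega(\mathbb{Z}^n,\mathbb{Z}^n)\subseteq\mathbb{Z}$. An integral representation $G\to\mathrm{GL}(n,\mathbb{Z})$ is called symplectic if it preserves a non-degenerate alternating two-form $\omega\in\bigwedge^2(\mathbb{Z}^n)^*$ (integer valued; non-degenerate means that no nonzero $v\in\mathbb{Z}^n$ satisfies $\omega(v,\cdot)=0$). *)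

theory Defs
  imports
    "HOL-Algebra.Coset"
    "HOL-Algebra.Generated_Groups"
    "Jordan_Normal_Form.Determinant"
begin

text \<open>
  Throughout, \<open>\<int>\<^sup>n\<close> and \<open>\<real>\<^sup>n\<close> are \<^term>\<open>carrier_vec n\<close> over \<^typ>\<open>int\<close> and \<^typ>\<open>real\<close>, and linear
  endomorphisms are identified with their matrices in the standard basis. The case \<open>n = 0\<close> is
  included.
\<close>

abbreviation
  "Z_group n \<equiv> add_monoid (module_vec TYPE(int) n)"

abbreviation GL_int :: "nat \<Rightarrow> int mat monoid" where
  "GL_int n \<equiv> units_of (ring_mat TYPE(int) n ())"

definition SL_int :: "nat \<Rightarrow> int mat set" where
  "SL_int n = {P \<in> carrier_mat n n. det P = 1}"

abbreviation real_vec :: "int vec \<Rightarrow> real vec" where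
  "real_vec \<equiv> map_vec real_of_int"

abbreviation real_mat :: "int mat \<Rightarrow> real mat" where
  "real_mat \<equiv> map_mat real_of_int"


definition finitely_generated :: "('a, 'b) monoid_scheme \<Rightarrow> bool" where
  "finitely_generated \<Gamma> \<longleftrightarrow>
     (\<exists>S. finite S \<and> S \<subseteq> carrier \<Gamma> \<and> generate \<Gamma> S = carrier \<Gamma>)"

definition virtually_abelian :: "('a, 'b) monoid_scheme \<Rightarrow> bool" where
  "virtually_abelian \<Gamma> \<longleftrightarrow>
     (\<exists>H. subgroup H \<Gamma> \<and> comm_group (\<Gamma>\<lparr>carrier := H\<rparr>) \<and> finite (rcosets\<^bsub>\<Gamma>\<^esub> H))"

definition short_exact ::
  "('a, 'b) monoid_scheme \<Rightarrow> ('c, 'd) monoid_scheme \<Rightarrow> ('e, 'f) monoid_scheme \<Rightarrow>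
     ('a \<Rightarrow> 'c) \<Rightarrow> ('c \<Rightarrow> 'e) \<Rightarrow> bool" where
  "short_exact A B C i p \<longleftrightarrow>
     i \<in> mon A B \<and> p \<in> epi B C \<and> i ` carrier A = kernel B C p"

text \<open>
  \<open>\<mu>(g)\<close> is the matrix of the automorphism of \<open>\<int>\<^sup>n\<close> that \<open>i\<close> transports to conjugation by any
  lift \<open>x\<close> of \<open>g\<close> to \<open>\<Gamma>\<close>; existence and uniqueness are the lemmas below.
\<close>

definition characteristic_rep ::
  "nat \<Rightarrow> ('a, 'b) monoid_scheme \<Rightarrow> (int vec \<Rightarrow> 'a) \<Rightarrow> ('a \<Rightarrow> 'c) \<Rightarrow> 'c \<Rightarrow> int mat" where
  "characteristic_rep n \<Gamma> i p g =
     (THE M. M \<in> carrier_mat n n \<and>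
        (\<forall>x \<in> carrier \<Gamma>. p x = g \<longrightarrow>
           (\<forall>v \<in> carrier_vec n. i (M *\<^sub>v v) = x \<otimes>\<^bsub>\<Gamma>\<^esub> i v \<otimes>\<^bsub>\<Gamma>\<^esub> inv\<^bsub>\<Gamma>\<^esub> x)))"


definition alternating_form :: "nat \<Rightarrow> ('a::comm_ring_1 vec \<Rightarrow> 'a vec \<Rightarrow> 'a) \<Rightarrow> bool" where
  "alternating_form n \<omega> \<longleftrightarrow>
     (\<forall>x \<in> carrier_vec n. \<forall>y \<in> carrier_vec n. \<forall>z \<in> carrier_vec n.
        \<omega> (x + y) z = \<omega> x z + \<omega> y z \<and> \<omega> x (y + z) = \<omega> x y + \<omega> x z) \<and>
     (\<forall>c. \<forall>x \<in> carrier_vec n. \<forall>y \<in> carrier_vec n.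
        \<omega> (c \<cdot>\<^sub>v x) y = c * \<omega> x y \<and> \<omega> x (c \<cdot>\<^sub>v y) = c * \<omega> x y) \<and>
     (\<forall>x \<in> carrier_vec n. \<omega> x x = 0)"

definition complex_structure :: "nat \<Rightarrow> real mat \<Rightarrow> bool" where
  "complex_structure n J \<longleftrightarrow> J \<in> carrier_mat n n \<and> J * J = - 1\<^sub>m n"

definition rep_invariant :: "('c, 'd) monoid_scheme \<Rightarrow> ('c \<Rightarrow> int mat) \<Rightarrow> real mat \<Rightarrow> bool" where
  "rep_invariant G \<rho> J \<longleftrightarrow> (\<forall>g \<in> carrier G. real_mat (\<rho> g) * J = J * real_mat (\<rho> g))"

text \<open>For a complex structure \<open>J\<close>, symmetry of \<open>\<omega>(J\<cdot>,\<cdot>)\<close> follows from the first two conditions.\<close>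

definition polarisable :: "nat \<Rightarrow> real mat \<Rightarrow> bool" where
  "polarisable n J \<longleftrightarrow>
     (\<exists>\<omega>. alternating_form n \<omega> \<and>
        (\<forall>x \<in> carrier_vec n. \<forall>y \<in> carrier_vec n. \<omega> (J *\<^sub>v x) (J *\<^sub>v y) = \<omega> x y) \<and>
        (\<forall>x \<in> carrier_vec n. x \<noteq> 0\<^sub>v n \<longrightarrow> \<omega> (J *\<^sub>v x) x > 0) \<and>
        (\<forall>x \<in> carrier_vec n. \<forall>y \<in> carrier_vec n. \<omega> (real_vec x) (real_vec y) \<in> \<int>))"

definition admits_polarisable_complex_structure ::
  "nat \<Rightarrow> ('a, 'b) monoid_scheme \<Rightarrow> ('c, 'd) monoid_scheme \<Rightarrow> (int vec \<Rightarrow> 'a) \<Rightarrow> ('a \<Rightarrow> 'c) \<Rightarrow> bool"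
  where
  "admits_polarisable_complex_structure n \<Gamma> G i p \<longleftrightarrow>
     (\<exists>J. complex_structure n J \<and> rep_invariant G (characteristic_rep n \<Gamma> i p) J \<and>
        polarisable n J)"


definition nondegenerate :: "nat \<Rightarrow> (int vec \<Rightarrow> int vec \<Rightarrow> int) \<Rightarrow> bool" where
  "nondegenerate n \<omega> \<longleftrightarrow>
     (\<forall>v \<in> carrier_vec n. (\<forall>w \<in> carrier_vec n. \<omega> v w = 0) \<longrightarrow> v = 0\<^sub>v n)"

definition symplectic_rep :: "nat \<Rightarrow> ('c, 'd) monoid_scheme \<Rightarrow> ('c \<Rightarrow> int mat) \<Rightarrow> bool" where
  "symplectic_rep n G \<rho> \<longleftrightarrow>
     \<rho> \<in> hom G (GL_int n) \<and>
     (\<exists>\<omega>. alternating_form n \<omega> \<and> nondegenerate n \<omega> \<and>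
        (\<forall>g \<in> carrier G. \<forall>x \<in> carrier_vec n. \<forall>y \<in> carrier_vec n.
           \<omega> (\<rho> g *\<^sub>v x) (\<rho> g *\<^sub>v y) = \<omega> x y))"

definition SL_conjugate ::
  "nat \<Rightarrow> ('c, 'd) monoid_scheme \<Rightarrow> ('c \<Rightarrow> int mat) \<Rightarrow> ('c \<Rightarrow> int mat) \<Rightarrow> bool" where
  "SL_conjugate n G \<rho> \<sigma> \<longleftrightarrow>
     (\<exists>P \<in> SL_int n. \<forall>g \<in> carrier G. \<sigma> g = P * \<rho> g * inv\<^bsub>GL_int n\<^esub> P)"


lemma ex1_characteristic_rep:
  fixes \<Gamma> :: "('a, 'b) monoid_scheme" and G :: "('c, 'd) monoid_scheme"
  assumes "group \<Gamma>" "group G" "short_exact (Z_group n) \<Gamma> G i p" "g \<in> carrier G"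
  shows "\<exists>!M. M \<in> carrier_mat n n \<and>
        (\<forall>x \<in> carrier \<Gamma>. p x = g \<longrightarrow>
           (\<forall>v \<in> carrier_vec n. i (M *\<^sub>v v) = x \<otimes>\<^bsub>\<Gamma>\<^esub> i v \<otimes>\<^bsub>\<Gamma>\<^esub> inv\<^bsub>\<Gamma>\<^esub> x))"
proof -
  interpret \<Gamma>: group \<Gamma> by fact
  interpret G: group G by fact
  have ih: "i \<in> hom (Z_group n) \<Gamma>" and inj: "inj_on i (carrier_vec n)"
    and ph: "p \<in> hom \<Gamma> G" and surj: "p ` carrier \<Gamma> = carrier G"
    and ker: "i ` carrier_vec n = kernel \<Gamma> G p"
    using assms(3) by (auto simp: short_exact_def mon_def epi_def module_vec_simps)
  interpret p: group_hom \<Gamma> G p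
    by unfold_locales (fact ph)
  have ic: "i v \<in> carrier \<Gamma>" if "v \<in> carrier_vec n" for v
    using ker that by (auto simp: kernel_def)
  have ia: "i (v + w) = i v \<otimes>\<^bsub>\<Gamma>\<^esub> i w" if "v \<in> carrier_vec n" "w \<in> carrier_vec n" for v w
    using ih that by (auto simp: hom_def module_vec_simps)
  obtain x0 where x0: "x0 \<in> carrier \<Gamma>" "p x0 = g"
    using surj assms(4) by (metis imageE)
  define f where "f v = inv_into (carrier_vec n) i (x0 \<otimes>\<^bsub>\<Gamma>\<^esub> i v \<otimes>\<^bsub>\<Gamma>\<^esub> inv\<^bsub>\<Gamma>\<^esub> x0)" for v
  have mem: "x0 \<otimes>\<^bsub>\<Gamma>\<^esub> i v \<otimes>\<^bsub>\<Gamma>\<^esub> inv\<^bsub>\<Gamma>\<^esub> x0 \<in> i ` carrier_vec n" if "v \<in> carrier_vec n" for v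
  proof -
    have "i v \<in> kernel \<Gamma> G p" using ker that by auto
    then have "p (i v) = \<one>\<^bsub>G\<^esub>" by (auto simp: kernel_def)
    then show ?thesis unfolding ker using x0 ic[OF that] assms(4)
      by (simp add: kernel_def)
  qed
  have fc: "f v \<in> carrier_vec n" if "v \<in> carrier_vec n" for v
    unfolding f_def using mem[OF that] by (rule inv_into_into)
  have fi: "i (f v) = x0 \<otimes>\<^bsub>\<Gamma>\<^esub> i v \<otimes>\<^bsub>\<Gamma>\<^esub> inv\<^bsub>\<Gamma>\<^esub> x0" if "v \<in> carrier_vec n" for v
    unfolding f_def using mem[OF that] by (rule f_inv_into_f)
  have fa: "f (v + w) = f v + f w" if v: "v \<in> carrier_vec n" and w: "w \<in> carrier_vec n" for v w
  proof (rule inj_onD[OF inj])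
    show "i (f (v + w)) = i (f v + f w)"
      using v w fc x0 ic by (simp add: fi ia \<Gamma>.m_assoc \<Gamma>.inv_solve_left)
  qed (use v w fc in auto)
  have f0: "f (0\<^sub>v n) = 0\<^sub>v n"
  proof -
    have c: "f (0\<^sub>v n) \<in> carrier_vec n" by (rule fc) simp
    have eq: "f (0\<^sub>v n) = f (0\<^sub>v n) + f (0\<^sub>v n)"
      using fa[of "0\<^sub>v n" "0\<^sub>v n"] by simp
    show ?thesis
    proof (rule eq_vecI)
      fix j assume "j < dim_vec (0\<^sub>v n :: int vec)"
      then have "f (0\<^sub>v n) $ j = f (0\<^sub>v n) $ j + f (0\<^sub>v n) $ j"
        using c by (subst eq) simp
      then show "f (0\<^sub>v n) $ j = 0\<^sub>v n $ j"
        using \<open>j < _\<close> by simp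
    qed (use c in simp)
  qed
  have fm: "f ((- v)) = - f v" if v: "v \<in> carrier_vec n" for v
  proof -
    have eq: "f v + f (- v) = 0\<^sub>v n" using fa[of v "- v"] v f0 by simp
    show ?thesis
    proof (rule eq_vecI)
      fix j assume j: "j < dim_vec (- f v)"
      then have "(f v + f (- v)) $ j = 0" using eq fc[OF v] by simp
      then show "f (- v) $ j = (- f v) $ j" using j fc[OF v] fc[of "- v"] v by simp
    qed (use v fc[OF v] fc[of "- v"] in simp)
  qed
  have fn: "f (of_nat k \<cdot>\<^sub>v v) = of_nat k \<cdot>\<^sub>v f v" if v: "v \<in> carrier_vec n" for v k
  proof (induction k)
    case 0
    have "of_nat 0 \<cdot>\<^sub>v w = (0\<^sub>v n :: int vec)" if "w \<in> carrier_vec n" for w :: "int vec"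
      using that by (intro eq_vecI) auto
    then show ?case using f0 v fc[OF v] by metis
  next
    case (Suc k)
    then show ?case using v fc[OF v] fa[of v "of_nat k \<cdot>\<^sub>v v"]
      by (simp add: add_smult_distrib_vec)
  qed
  have fs: "f (c \<cdot>\<^sub>v v) = c \<cdot>\<^sub>v f v" if v: "v \<in> carrier_vec n" for c v
  proof (cases "c \<ge> 0")
    case True
    then show ?thesis using fn[OF v, of "nat c"] by simp
  next
    case False
    have "c \<cdot>\<^sub>v v = - (of_nat (nat (- c)) \<cdot>\<^sub>v v)" "c \<cdot>\<^sub>v f v = - (of_nat (nat (- c)) \<cdot>\<^sub>v f v)"
      using False v fc[OF v] by (auto intro!: eq_vecI)
    then show ?thesis
      using fm[OF iffD2[OF smult_carrier_vec v]] fn[OF v] by metis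
  qed
  define M where "M = mat n n (\<lambda>(r, s). f (unit_vec n s) $ r)"
  have Mc: "M \<in> carrier_mat n n" by (simp add: M_def)
  have Mu: "M *\<^sub>v unit_vec n s = f (unit_vec n s)" if "s < n" for s
    using that fc[of "unit_vec n s"] by (intro eq_vecI) (auto simp: M_def)
  have Ms: "M *\<^sub>v (c \<cdot>\<^sub>v v) = c \<cdot>\<^sub>v (M *\<^sub>v v)" if "v \<in> carrier_vec n" for c v
    using that Mc by (intro eq_vecI) auto
  have partial: "M *\<^sub>v vec n (\<lambda>j. if j < k then v $ j else 0) = f (vec n (\<lambda>j. if j < k then v $ j else 0))"
    if v: "v \<in> carrier_vec n" and "k \<le> n" for v :: "int vec" and k
    using \<open>k \<le> n\<close>
  proof (induction k)
    case 0
    have "vec n (\<lambda>j. if j < 0 then v $ j else 0) = 0\<^sub>v n" by auto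
    moreover have "M *\<^sub>v 0\<^sub>v n = 0\<^sub>v n" using Mc by (intro eq_vecI) auto
    ultimately show ?case using f0 by simp
  next
    case (Suc k)
    have *: "vec n (\<lambda>j. if j < Suc k then v $ j else 0)
       = vec n (\<lambda>j. if j < k then v $ j else 0) + v $ k \<cdot>\<^sub>v unit_vec n k"
      using Suc.prems by (auto simp: unit_vec_def less_Suc_eq)
    show ?case unfolding * using Suc Mc
      by (simp add: mult_add_distrib_mat_vec[of _ n n] fa fs Mu Ms)
  qed
  have Mf: "M *\<^sub>v v = f v" if v: "v \<in> carrier_vec n" for v
  proof -
    have "vec n (\<lambda>j. if j < n then v $ j else 0) = v" using v by auto
    then show ?thesis using partial[OF v, of n] by simp
  qed
  have comm: "i u \<otimes>\<^bsub>\<Gamma>\<^esub> i v = i v \<otimes>\<^bsub>\<Gamma>\<^esub> i u" if "u \<in> carrier_vec n" "v \<in> carrier_vec n" for u v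
    using ia[of u v] ia[of v u] comm_add_vec[of u n v] that by simp
  show ?thesis
  proof (rule ex1I[of _ M], intro conjI ballI impI)
    fix x and v :: "int vec" assume x: "x \<in> carrier \<Gamma>" "p x = g" and v: "v \<in> carrier_vec n"
    have "inv\<^bsub>\<Gamma>\<^esub> x0 \<otimes>\<^bsub>\<Gamma>\<^esub> x \<in> kernel \<Gamma> G p"
      using x x0 assms(4) by (simp add: kernel_def)
    then obtain u where u: "u \<in> carrier_vec n" "i u = inv\<^bsub>\<Gamma>\<^esub> x0 \<otimes>\<^bsub>\<Gamma>\<^esub> x"
      unfolding ker[symmetric] by auto
    have xe: "x = x0 \<otimes>\<^bsub>\<Gamma>\<^esub> i u"
      using u x x0 by (simp add: \<Gamma>.m_assoc[symmetric])
    have "x \<otimes>\<^bsub>\<Gamma>\<^esub> i v \<otimes>\<^bsub>\<Gamma>\<^esub> inv\<^bsub>\<Gamma>\<^esub> x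
        = x0 \<otimes>\<^bsub>\<Gamma>\<^esub> (i u \<otimes>\<^bsub>\<Gamma>\<^esub> i v) \<otimes>\<^bsub>\<Gamma>\<^esub> inv\<^bsub>\<Gamma>\<^esub> (i u) \<otimes>\<^bsub>\<Gamma>\<^esub> inv\<^bsub>\<Gamma>\<^esub> x0"
      unfolding xe using x0 ic[OF u(1)] ic[OF v] by (simp add: \<Gamma>.inv_mult_group \<Gamma>.m_assoc)
    also have "\<dots> = x0 \<otimes>\<^bsub>\<Gamma>\<^esub> i v \<otimes>\<^bsub>\<Gamma>\<^esub> inv\<^bsub>\<Gamma>\<^esub> x0"
      unfolding comm[OF u(1) v] using x0 ic[OF u(1)] ic[OF v] by (simp add: \<Gamma>.m_assoc)
    finally show "i (M *\<^sub>v v) = x \<otimes>\<^bsub>\<Gamma>\<^esub> i v \<otimes>\<^bsub>\<Gamma>\<^esub> inv\<^bsub>\<Gamma>\<^esub> x"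
      using Mf[OF v] fi[OF v] by simp
  next
    fix N assume N: "N \<in> carrier_mat n n \<and>
        (\<forall>x \<in> carrier \<Gamma>. p x = g \<longrightarrow>
           (\<forall>v \<in> carrier_vec n. i (N *\<^sub>v v) = x \<otimes>\<^bsub>\<Gamma>\<^esub> i v \<otimes>\<^bsub>\<Gamma>\<^esub> inv\<^bsub>\<Gamma>\<^esub> x))"
    have NM: "N *\<^sub>v v = M *\<^sub>v v" if v: "v \<in> carrier_vec n" for v
    proof (rule inj_onD[OF inj])
      show "i (N *\<^sub>v v) = i (M *\<^sub>v v)"
        using N x0 v Mf[OF v] fi[OF v] by auto
    qed (use N Mc v in auto)
    have "col N s = col M s" if "s < n" for s
    proof -
      have "A *\<^sub>v unit_vec n s = col A s" if "A \<in> carrier_mat n n" for A :: "int mat"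
        using that \<open>s < n\<close> by (intro eq_vecI) auto
      then show ?thesis using N Mc NM[of "unit_vec n s"] by simp
    qed
    then show "N = M" using N Mc by (intro mat_col_eqI) auto
  qed (fact Mc)
qed

lemma characteristic_rep:
  assumes "group \<Gamma>" "group G" "short_exact (Z_group n) \<Gamma> G i p" "x \<in> carrier \<Gamma>"
  shows "characteristic_rep n \<Gamma> i p (p x) \<in> carrier_mat n n"
    and "v \<in> carrier_vec n \<Longrightarrow>
      i (characteristic_rep n \<Gamma> i p (p x) *\<^sub>v v) = x \<otimes>\<^bsub>\<Gamma>\<^esub> i v \<otimes>\<^bsub>\<Gamma>\<^esub> inv\<^bsub>\<Gamma>\<^esub> x"
proof -
  have "p x \<in> carrier G"
    using assms(3,4) by (auto simp: short_exact_def epi_def)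
  from theI'[OF ex1_characteristic_rep[OF assms(1-3) this]] assms(4)
  show "characteristic_rep n \<Gamma> i p (p x) \<in> carrier_mat n n"
    and "v \<in> carrier_vec n \<Longrightarrow>
      i (characteristic_rep n \<Gamma> i p (p x) *\<^sub>v v) = x \<otimes>\<^bsub>\<Gamma>\<^esub> i v \<otimes>\<^bsub>\<Gamma>\<^esub> inv\<^bsub>\<Gamma>\<^esub> x"
    unfolding characteristic_rep_def by auto
qed

end

(*
  Conjugation by P in SL_n(Z) transports invariant symplectic forms, so the second condition only
  says that mu itself preserves a non-degenerate integral alternating form. Averaging a polarisation
  over G keeps it integral, J-compatible and positive, and positivity forces non-degeneracy.
  Conversely, given an invariant integral form omega, average the standard inner product over G and
  write omega(x, y) = <x, A y>. Then A is skew, invertible and commutes with G, and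
  J = -A^{-1} sqrt(-A^2) is the required complex structure. The square root is a limit of
  polynomials in A, so it commutes with whatever commutes with A.
*)

theory Submission
  imports Defs
begin

subsection \<open>Bilinear forms on coordinate spaces\<close>

text \<open>The inner product is averaged because A compares two forms: a group element that
  preserves both omega and the inner product commutes with A, while for the standard inner product
  nothing ties A to G. The obstacle is the square root. Instead of diagonalising -A^2, a fixed point
  iteration is run in a matrix B that is polynomial in A; self-adjointness, the norm bound and
  commutation hold for every iterate and survive the limit, and positivity follows because the norm
  bound stays below 1. Making that bound strict uses that both A and its inverse are bounded. The
  other delicate point is the change of scalars. Non-degeneracy is given only for integer vectors,
  but A must be invertible over the reals. Conversely, the restriction of a polarisation to the
  lattice is tested against J v, which need not be a lattice vector.\<close>

definition bilinear_form :: "nat \<Rightarrow> ('a::comm_ring_1 vec \<Rightarrow> 'a vec \<Rightarrow> 'a) \<Rightarrow> bool" where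
  "bilinear_form n \<beta> \<longleftrightarrow>
     (\<forall>x \<in> carrier_vec n. \<forall>y \<in> carrier_vec n. \<forall>z \<in> carrier_vec n.
        \<beta> (x + y) z = \<beta> x z + \<beta> y z \<and> \<beta> x (y + z) = \<beta> x y + \<beta> x z) \<and>
     (\<forall>c. \<forall>x \<in> carrier_vec n. \<forall>y \<in> carrier_vec n.
        \<beta> (c \<cdot>\<^sub>v x) y = c * \<beta> x y \<and> \<beta> x (c \<cdot>\<^sub>v y) = c * \<beta> x y)"

text \<open>Splitting off bilinearity lets one set of rules serve both the alternating forms and the
  inner products, over the integers and over the reals.\<close>

lemma alternating_form_iff:
  "alternating_form n \<omega> \<longleftrightarrow> bilinear_form n \<omega> \<and> (\<forall>x \<in> carrier_vec n. \<omega> x x = 0)"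
  by (auto simp: alternating_form_def bilinear_form_def)

lemma bilinear_formD:
  assumes "bilinear_form n \<beta>" "x \<in> carrier_vec n" "y \<in> carrier_vec n"
  shows "z \<in> carrier_vec n \<Longrightarrow> \<beta> (x + y) z = \<beta> x z + \<beta> y z"
    and "z \<in> carrier_vec n \<Longrightarrow> \<beta> z (x + y) = \<beta> z x + \<beta> z y"
    and "\<beta> (c \<cdot>\<^sub>v x) y = c * \<beta> x y"
    and "\<beta> x (c \<cdot>\<^sub>v y) = c * \<beta> x y"
    and "z \<in> carrier_vec n \<Longrightarrow> \<beta> (x - y) z = \<beta> x z - \<beta> y z"
    and "z \<in> carrier_vec n \<Longrightarrow> \<beta> z (x - y) = \<beta> z x - \<beta> z y"
    and "\<beta> (- x) y = - \<beta> x y"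
    and "\<beta> x (- y) = - \<beta> x y"
    and "\<beta> (0\<^sub>v n) y = 0"
    and "\<beta> x (0\<^sub>v n) = 0"
proof -
  have add: "\<beta> (x + y) z = \<beta> x z + \<beta> y z" "\<beta> z (x + y) = \<beta> z x + \<beta> z y"
    if "x \<in> carrier_vec n" "y \<in> carrier_vec n" "z \<in> carrier_vec n" for x y z
    using assms(1) that by (auto simp: bilinear_form_def)
  have smult: "\<beta> (c \<cdot>\<^sub>v x) y = c * \<beta> x y" "\<beta> x (c \<cdot>\<^sub>v y) = c * \<beta> x y"
    if "x \<in> carrier_vec n" "y \<in> carrier_vec n" for x y c
    using assms(1) that by (auto simp: bilinear_form_def)
  have m: "- x = (- 1) \<cdot>\<^sub>v x" for x :: "'a vec" by auto
  have d: "x - y = x + (- 1) \<cdot>\<^sub>v y" if "x \<in> carrier_vec n" "y \<in> carrier_vec n" for x y :: "'a vec"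
    using that by auto
  have z: "0\<^sub>v n = 0 \<cdot>\<^sub>v x" "0\<^sub>v n = 0 \<cdot>\<^sub>v y" using assms by auto
  show "z \<in> carrier_vec n \<Longrightarrow> \<beta> (x + y) z = \<beta> x z + \<beta> y z"
    "z \<in> carrier_vec n \<Longrightarrow> \<beta> z (x + y) = \<beta> z x + \<beta> z y"
    "\<beta> (c \<cdot>\<^sub>v x) y = c * \<beta> x y" "\<beta> x (c \<cdot>\<^sub>v y) = c * \<beta> x y"
    "z \<in> carrier_vec n \<Longrightarrow> \<beta> (x - y) z = \<beta> x z - \<beta> y z"
    "z \<in> carrier_vec n \<Longrightarrow> \<beta> z (x - y) = \<beta> z x - \<beta> z y"
    using assms(2,3) by (simp_all add: add smult d)
  show "\<beta> (- x) y = - \<beta> x y" "\<beta> x (- y) = - \<beta> x y"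
    unfolding m using assms(2,3) by (simp_all only: smult) simp_all
  show "\<beta> (0\<^sub>v n) y = 0"
    unfolding z(1) using assms(2,3) by (simp only: smult) simp
  show "\<beta> x (0\<^sub>v n) = 0"
    unfolding z(2) using assms(2,3) by (simp only: smult) simp
qed

lemma alternating_form_skew:
  assumes "alternating_form n \<omega>" "x \<in> carrier_vec n" "y \<in> carrier_vec n"
  shows "\<omega> x y = - \<omega> y x"
proof -
  have b: "bilinear_form n \<omega>" and a: "\<And>x. x \<in> carrier_vec n \<Longrightarrow> \<omega> x x = 0"
    using assms(1) by (auto simp: alternating_form_iff)
  have "\<omega> (x + y) (x + y) = \<omega> x x + \<omega> x y + (\<omega> y x + \<omega> y y)"
    using assms(2,3) by (simp add: bilinear_formD[OF b])
  then show ?thesis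
    using assms(2,3) a[of "x + y"] a[of x] a[of y] by (simp add: eq_neg_iff_add_eq_0)
qed

lemma linear_expansion:
  fixes f :: "'a::comm_ring_1 vec \<Rightarrow> 'a"
  assumes add: "\<And>x y. x \<in> carrier_vec n \<Longrightarrow> y \<in> carrier_vec n \<Longrightarrow> f (x + y) = f x + f y"
    and smult: "\<And>c x. x \<in> carrier_vec n \<Longrightarrow> f (c \<cdot>\<^sub>v x) = c * f x"
    and x: "x \<in> carrier_vec n"
  shows "f x = (\<Sum>j<n. x $ j * f (unit_vec n j))"
proof -
  \<comment> \<open>Induction on truncations of \<open>x\<close> to its first \<open>k\<close>
    coordinates: each step adds a single multiple of a unit vector.\<close>
  have "f (vec n (\<lambda>j. if j < k then x $ j else 0)) = (\<Sum>j<k. x $ j * f (unit_vec n j))" if "k \<le> n" for k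
    using that
  proof (induction k)
    case 0
    have "vec n (\<lambda>j. if j < 0 then x $ j else 0) = 0 \<cdot>\<^sub>v x" using x by auto
    then show ?case using smult[OF x, of 0] by simp
  next
    case (Suc k)
    have *: "vec n (\<lambda>j. if j < Suc k then x $ j else 0)
       = vec n (\<lambda>j. if j < k then x $ j else 0) + x $ k \<cdot>\<^sub>v unit_vec n k"
      using Suc.prems by (auto simp: unit_vec_def less_Suc_eq)
    show ?case unfolding * using Suc by (simp add: add smult)
  qed
  from this[of n] have "f (vec n (\<lambda>j. if j < n then x $ j else 0)) = (\<Sum>j<n. x $ j * f (unit_vec n j))"
    by simp
  moreover have "vec n (\<lambda>j. if j < n then x $ j else 0) = x" using x by auto
  ultimately show ?thesis by simp
qed

lemma bilinear_form_expansion_left: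
  assumes "bilinear_form n \<beta>" "x \<in> carrier_vec n" "y \<in> carrier_vec n"
  shows "\<beta> x y = (\<Sum>j<n. x $ j * \<beta> (unit_vec n j) y)"
  using assms by (intro linear_expansion) (auto simp: bilinear_formD)

lemma bilinear_form_expansion_right:
  assumes "bilinear_form n \<beta>" "x \<in> carrier_vec n" "y \<in> carrier_vec n"
  shows "\<beta> x y = (\<Sum>j<n. y $ j * \<beta> x (unit_vec n j))"
  using assms by (intro linear_expansion) (auto simp: bilinear_formD)

definition gram_mat :: "nat \<Rightarrow> ('a::comm_ring_1 vec \<Rightarrow> 'a vec \<Rightarrow> 'a) \<Rightarrow> 'a mat" where
  "gram_mat n \<beta> = mat n n (\<lambda>(a, b). \<beta> (unit_vec n a) (unit_vec n b))"

lemma gram_mat_carrier [simp]: "gram_mat n \<beta> \<in> carrier_mat n n"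
  by (simp add: gram_mat_def)

lemma gram_mat:
  assumes "bilinear_form n \<beta>" "x \<in> carrier_vec n" "y \<in> carrier_vec n"
  shows "\<beta> x y = x \<bullet> (gram_mat n \<beta> *\<^sub>v y)"
proof -
  have "(gram_mat n \<beta> *\<^sub>v y) $ a = \<beta> (unit_vec n a) y" if "a < n" for a
    using that assms(3) bilinear_form_expansion_right[OF assms(1) unit_vec_carrier assms(3), of a]
    by (simp add: gram_mat_def scalar_prod_def lessThan_atLeast0 mult.commute)
  then show ?thesis
    using bilinear_form_expansion_left[OF assms] by (simp add: scalar_prod_def gram_mat_def lessThan_atLeast0)
qed

lemma bilinear_form_scalar_prod: "bilinear_form n (\<lambda>x y. x \<bullet> y)"
  by (auto simp: bilinear_form_def scalar_prod_add_distrib[of _ n] add_scalar_prod_distrib[of _ n])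

section \<open>Matrix-vector arithmetic and bounds for forms\<close>

lemma square_mat_mult_carrier [simp]:
  "M \<in> carrier_mat n n \<Longrightarrow> N \<in> carrier_mat n n \<Longrightarrow> M * N \<in> carrier_mat n n"
  by (rule mult_carrier_mat)

lemma square_mat_mult_vec_carrier [simp]:
  "M \<in> carrier_mat n n \<Longrightarrow> x \<in> carrier_vec n \<Longrightarrow> M *\<^sub>v x \<in> carrier_vec n"
  by (rule mult_mat_vec_carrier)

lemma mult_mat_vec_smult:
  fixes M :: "'a::comm_ring_1 mat"
  assumes "M \<in> carrier_mat m n" "x \<in> carrier_vec n"
  shows "M *\<^sub>v (c \<cdot>\<^sub>v x) = c \<cdot>\<^sub>v (M *\<^sub>v x)"
  using assms by (intro eq_vecI) auto

lemma smult_mat_mult_vec: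
  fixes M :: "'a::comm_ring_1 mat"
  assumes "M \<in> carrier_mat m n" "x \<in> carrier_vec n"
  shows "(c \<cdot>\<^sub>m M) *\<^sub>v x = c \<cdot>\<^sub>v (M *\<^sub>v x)"
  using assms by (intro eq_vecI) auto

lemma vec_eq_if_diff_eq_0:
  fixes u v :: "'a::ab_group_add vec"
  assumes "u \<in> carrier_vec n" "v \<in> carrier_vec n" "u - v = 0\<^sub>v n"
  shows "u = v"
proof (rule eq_vecI)
  fix k assume "k < dim_vec v"
  then show "u $ k = v $ k"
    using arg_cong[OF assms(3), of "\<lambda>z. z $ k"] assms(1,2) by simp
qed (use assms in simp)

lemma bilinear_form_compose:
  assumes "bilinear_form n \<beta>" "M \<in> carrier_mat n n" "N \<in> carrier_mat n n"
  shows "bilinear_form n (\<lambda>x y. \<beta> (M *\<^sub>v x) (N *\<^sub>v y))"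
  unfolding bilinear_form_def
  using assms by (auto simp: mult_add_distrib_mat_vec[of _ n n] mult_mat_vec_smult[of _ n n] bilinear_formD[OF assms(1)])

lemma bilinear_form_sum:
  assumes "\<And>g. g \<in> S \<Longrightarrow> bilinear_form n (\<beta> g)"
  shows "bilinear_form n (\<lambda>x y. \<Sum>g\<in>S. \<beta> g x y)"
  using assms by (auto simp: bilinear_form_def sum.distrib sum_distrib_left)

text \<open>Every product of two coordinates is at most \<open>x \<bullet> x\<close> in absolute
  value, so the absolute values of the Gram entries add up to a bound.\<close>

lemma bilinear_form_bound:
  fixes \<beta> :: "real vec \<Rightarrow> real vec \<Rightarrow> real"
  assumes "bilinear_form n \<beta>"
  obtains K where "K > 0" "\<And>x. x \<in> carrier_vec n \<Longrightarrow> \<bar>\<beta> x x\<bar> \<le> K * (x \<bullet> x)"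
proof -
  \<comment> \<open>The summand 1 keeps \<open>K\<close> strictly positive for the zero form and in
    dimension 0; later arguments divide by such constants.\<close>
  define K where "K = 1 + (\<Sum>a<n. \<Sum>b<n. \<bar>\<beta> (unit_vec n a) (unit_vec n b)\<bar>)"
  have "K > 0" unfolding K_def by (intro add_pos_nonneg sum_nonneg) auto
  moreover have "\<bar>\<beta> x x\<bar> \<le> K * (x \<bullet> x)" if x: "x \<in> carrier_vec n" for x
  proof -
    have sq: "x \<bullet> x = (\<Sum>a<n. (x $ a)\<^sup>2)"
      using x by (simp add: scalar_prod_def lessThan_atLeast0 power2_eq_square)
    have entry: "(x $ a)\<^sup>2 \<le> x \<bullet> x" if "a < n" for a
      unfolding sq using that by (intro member_le_sum) auto
    have "\<bar>x $ a * x $ b\<bar> \<le> x \<bullet> x" if "a < n" "b < n" for a b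
    proof -
      have "2 * \<bar>x $ a * x $ b\<bar> \<le> (x $ a)\<^sup>2 + (x $ b)\<^sup>2"
        using sum_squares_bound[of "\<bar>x $ a\<bar>" "\<bar>x $ b\<bar>"] by (simp add: abs_mult)
      then show ?thesis using entry[OF that(1)] entry[OF that(2)] by simp
    qed
    then have *: "\<bar>x $ a * x $ b * \<beta> (unit_vec n a) (unit_vec n b)\<bar>
        \<le> \<bar>\<beta> (unit_vec n a) (unit_vec n b)\<bar> * (x \<bullet> x)" if "a < n" "b < n" for a b
      using that by (subst abs_mult, subst mult.commute) (intro mult_left_mono, auto)
    have "\<beta> x x = (\<Sum>a<n. \<Sum>b<n. x $ a * x $ b * \<beta> (unit_vec n a) (unit_vec n b))"
      unfolding bilinear_form_expansion_left[OF assms x x]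
      using bilinear_form_expansion_right[OF assms unit_vec_carrier x]
      by (simp add: sum_distrib_left mult.assoc)
    also have "\<bar>\<dots>\<bar> \<le> (\<Sum>a<n. \<Sum>b<n. \<bar>\<beta> (unit_vec n a) (unit_vec n b)\<bar> * (x \<bullet> x))"
      by (intro order_trans[OF sum_abs] sum_mono) (simp add: *)
    also have "\<dots> = (K - 1) * (x \<bullet> x)" by (simp add: K_def sum_distrib_right)
    also have "\<dots> \<le> K * (x \<bullet> x)" by (simp add: algebra_simps sq sum_nonneg)
    finally show ?thesis .
  qed
  ultimately show ?thesis by (rule that)
qed

lemma mat_eq_if_mult_vec_eq:
  fixes M N :: "'a::comm_ring_1 mat"
  assumes "M \<in> carrier_mat n n" "N \<in> carrier_mat n n"
    and "\<And>x. x \<in> carrier_vec n \<Longrightarrow> M *\<^sub>v x = N *\<^sub>v x"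
  shows "M = N"
proof (intro mat_col_eqI)
  fix s assume "s < dim_col N"
  then have s: "s < n" using assms by simp
  have "A *\<^sub>v unit_vec n s = col A s" if "A \<in> carrier_mat n n" for A :: "'a mat"
    using that s by (intro eq_vecI) auto
  then show "col M s = col N s" using assms(1,2) assms(3)[of "unit_vec n s"] by simp
qed (use assms in auto)

lemma trivial_kernel_inverse:
  fixes A :: "'a::field mat"
  assumes A: "A \<in> carrier_mat n n"
    and ker: "\<And>x. x \<in> carrier_vec n \<Longrightarrow> A *\<^sub>v x = 0\<^sub>v n \<Longrightarrow> x = 0\<^sub>v n"
  obtains B where "B \<in> carrier_mat n n" "A * B = 1\<^sub>m n" "B * A = 1\<^sub>m n"
proof -
  have "det A \<noteq> 0" using det_0_iff_vec_prod_zero[OF A] ker by blast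
  from det_non_zero_imp_unit[OF A this, of "()"] that show ?thesis
    by (auto simp: Units_def ring_mat_simps)
qed


subsection \<open>Entrywise limits of matrices\<close>

text \<open>Dimensions are values here and not part of the type, so convergence is stated entry by
  entry and carries the dimensions along. Entries of sums and products are polynomials in the
  entries of the factors, which gives the limit rules.\<close>

definition mat_tendsto :: "nat \<Rightarrow> (nat \<Rightarrow> real mat) \<Rightarrow> real mat \<Rightarrow> bool" where
  "mat_tendsto n X L \<longleftrightarrow> (\<forall>k. X k \<in> carrier_mat n n) \<and> L \<in> carrier_mat n n \<and>
     (\<forall>a<n. \<forall>b<n. (\<lambda>k. X k $$ (a, b)) \<longlonglongrightarrow> L $$ (a, b))"

lemma mat_tendsto_const: "M \<in> carrier_mat n n \<Longrightarrow> mat_tendsto n (\<lambda>k. M) M"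
  by (simp add: mat_tendsto_def)

lemma mat_tendsto_add:
  "mat_tendsto n X L \<Longrightarrow> mat_tendsto n Y M \<Longrightarrow> mat_tendsto n (\<lambda>k. X k + Y k) (L + M)"
proof -
  assume XL: "mat_tendsto n X L" and YM: "mat_tendsto n Y M"
  have c: "X k \<in> carrier_mat n n" "Y k \<in> carrier_mat n n" "L \<in> carrier_mat n n" "M \<in> carrier_mat n n" for k
    using XL YM by (auto simp: mat_tendsto_def)
  have entry: "(A + B) $$ (a, b) = A $$ (a, b) + B $$ (a, b)"
    if "A \<in> carrier_mat n n" "B \<in> carrier_mat n n" "a < n" "b < n" for A B :: "real mat" and a b
    using that by simp
  have "(\<lambda>k. (X k + Y k) $$ (a, b)) \<longlonglongrightarrow> (L + M) $$ (a, b)" if "a < n" "b < n" for a b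
    unfolding entry[OF c(1,2) that] entry[OF c(3,4) that]
    using XL YM that by (intro tendsto_add) (auto simp: mat_tendsto_def)
  then show ?thesis using c by (simp add: mat_tendsto_def)
qed

lemma mat_tendsto_smult: "mat_tendsto n X L \<Longrightarrow> mat_tendsto n (\<lambda>k. c \<cdot>\<^sub>m X k) (c \<cdot>\<^sub>m L)"
proof -
  assume XL: "mat_tendsto n X L"
  have c: "X k \<in> carrier_mat n n" "L \<in> carrier_mat n n" for k
    using XL by (auto simp: mat_tendsto_def)
  have entry: "(c \<cdot>\<^sub>m A) $$ (a, b) = c * A $$ (a, b)"
    if "A \<in> carrier_mat n n" "a < n" "b < n" for A :: "real mat" and a b
    using that by simp
  have "(\<lambda>k. (c \<cdot>\<^sub>m X k) $$ (a, b)) \<longlonglongrightarrow> (c \<cdot>\<^sub>m L) $$ (a, b)" if "a < n" "b < n" for a b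
    unfolding entry[OF c(1) that] entry[OF c(2) that]
    using XL that by (intro tendsto_mult_left) (auto simp: mat_tendsto_def)
  then show ?thesis using c by (simp add: mat_tendsto_def)
qed

lemma mat_tendsto_mult:
  assumes "mat_tendsto n X L" "mat_tendsto n Y M"
  shows "mat_tendsto n (\<lambda>k. X k * Y k) (L * M)"
proof -
  have entry: "(A * B) $$ (a, b) = (\<Sum>j<n. A $$ (a, j) * B $$ (j, b))"
    if "A \<in> carrier_mat n n" "B \<in> carrier_mat n n" "a < n" "b < n" for A B :: "real mat" and a b
    using that by (simp add: scalar_prod_def lessThan_atLeast0)
  have c: "X k \<in> carrier_mat n n" "Y k \<in> carrier_mat n n" "L \<in> carrier_mat n n" "M \<in> carrier_mat n n" for k
    using assms by (auto simp: mat_tendsto_def)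
  have "(\<lambda>k. (X k * Y k) $$ (a, b)) \<longlonglongrightarrow> (L * M) $$ (a, b)" if "a < n" "b < n" for a b
    unfolding entry[OF c(1,2) that] entry[OF c(3,4) that]
    using assms that by (intro tendsto_sum tendsto_mult) (auto simp: mat_tendsto_def)
  then show ?thesis using c by (simp add: mat_tendsto_def)
qed

lemma mat_tendsto_Suc: "mat_tendsto n X L \<Longrightarrow> mat_tendsto n (\<lambda>k. X (Suc k)) L"
  by (auto simp: mat_tendsto_def intro: LIMSEQ_Suc)

lemma mat_tendsto_unique:
  assumes "mat_tendsto n X L" "mat_tendsto n X M"
  shows "L = M"
proof -
  have c: "L \<in> carrier_mat n n" "M \<in> carrier_mat n n"
    using assms by (simp_all add: mat_tendsto_def)
  have "L $$ (a, b) = M $$ (a, b)" if "a < n" "b < n" for a b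
    by (rule LIMSEQ_unique[of "\<lambda>k. X k $$ (a, b)"]) (use assms that in \<open>simp_all add: mat_tendsto_def\<close>)
  then show ?thesis using c by (intro eq_matI) auto
qed

text \<open>For fixed \<open>x\<close> and \<open>y\<close> the value is a linear combination of the
  matrix entries. This is how identities and inequalities stated through a form reach the
  limit.\<close>

lemma mat_tendsto_form:
  assumes "mat_tendsto n X L" "bilinear_form n \<beta>" "x \<in> carrier_vec n" "y \<in> carrier_vec n"
  shows "(\<lambda>k. \<beta> (X k *\<^sub>v x) y) \<longlonglongrightarrow> \<beta> (L *\<^sub>v x) y"
proof -
  have *: "\<beta> (A *\<^sub>v x) y = (\<Sum>a<n. (\<Sum>b<n. A $$ (a, b) * x $ b) * \<beta> (unit_vec n a) y)"
    if "A \<in> carrier_mat n n" for A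
    using that assms(3)
    by (subst bilinear_form_expansion_left[OF assms(2) _ assms(4)])
      (auto simp: scalar_prod_def lessThan_atLeast0)
  have c: "X k \<in> carrier_mat n n" "L \<in> carrier_mat n n" for k
    using assms by (auto simp: mat_tendsto_def)
  show ?thesis
    unfolding *[OF c(1)] *[OF c(2)]
    using assms(1) by (intro tendsto_sum tendsto_mult tendsto_const) (auto simp: mat_tendsto_def)
qed


subsection \<open>Square roots of operators in an inner product\<close>

text \<open>Dominating the standard inner product turns operator bounds into bounds on matrix entries.\<close>

locale dominating_inner_product =
  fixes n :: nat and ip :: "real vec \<Rightarrow> real vec \<Rightarrow> real"
  assumes bilinear: "bilinear_form n ip"
    and sym: "x \<in> carrier_vec n \<Longrightarrow> y \<in> carrier_vec n \<Longrightarrow> ip x y = ip y x"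
    and dominating: "x \<in> carrier_vec n \<Longrightarrow> x \<bullet> x \<le> ip x x"
begin

definition nrm :: "real vec \<Rightarrow> real" where
  "nrm x = sqrt (ip x x)"

text \<open>Phrased through the form instead of \<open>nrm (M *\<^sub>v x)\<close>: sums then need
  only the triangle inequality of the reals, and limits pass through directly. The conjunct
  \<open>0 \<le> c\<close> has content in dimension 0, where the inequality holds for every
  \<open>c\<close>.\<close>

definition op_bound :: "real mat \<Rightarrow> real \<Rightarrow> bool" where
  "op_bound M c \<longleftrightarrow> 0 \<le> c \<and>
     (\<forall>x \<in> carrier_vec n. \<forall>y \<in> carrier_vec n. \<bar>ip (M *\<^sub>v x) y\<bar> \<le> c * nrm x * nrm y)"

definition self_adjoint :: "real mat \<Rightarrow> bool" where
  "self_adjoint M \<longleftrightarrow>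
     (\<forall>x \<in> carrier_vec n. \<forall>y \<in> carrier_vec n. ip (M *\<^sub>v x) y = ip x (M *\<^sub>v y))"

section \<open>The norm of the inner product\<close>

lemmas ip_simps = bilinear_formD[OF bilinear]

lemma ip_nonneg: "x \<in> carrier_vec n \<Longrightarrow> 0 \<le> ip x x"
  using dominating[of x] sum_nonneg[of "{0..<n}" "\<lambda>a. x $ a * x $ a"]
  by (simp add: scalar_prod_def)

lemma entry_le_nrm:
  assumes x: "x \<in> carrier_vec n" and a: "a < n"
  shows "\<bar>x $ a\<bar> \<le> nrm x"
proof -
  have "(x $ a)\<^sup>2 \<le> x \<bullet> x"
    using x a member_le_sum[of a "{..<n}" "\<lambda>a. (x $ a)\<^sup>2"]
    by (simp add: scalar_prod_def lessThan_atLeast0 power2_eq_square)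
  also have "\<dots> \<le> ip x x" using x by (rule dominating)
  finally show ?thesis unfolding nrm_def by (rule real_le_rsqrt[of "\<bar>x $ a\<bar>", simplified])
qed

lemma nrm_sq: "x \<in> carrier_vec n \<Longrightarrow> (nrm x)\<^sup>2 = ip x x"
  by (simp add: nrm_def ip_nonneg)

lemma nrm_nonneg: "x \<in> carrier_vec n \<Longrightarrow> 0 \<le> nrm x"
  by (simp add: nrm_def ip_nonneg)

lemma ip_eq_0: "x \<in> carrier_vec n \<Longrightarrow> ip x x = 0 \<Longrightarrow> x = 0\<^sub>v n"
  using entry_le_nrm[of x] by (intro eq_vecI) (auto simp: nrm_def)

lemma ip_pos: "x \<in> carrier_vec n \<Longrightarrow> x \<noteq> 0\<^sub>v n \<Longrightarrow> 0 < ip x x"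
  using ip_nonneg[of x] ip_eq_0[of x] by force

lemma Cauchy_Schwarz:
  assumes x: "x \<in> carrier_vec n" and y: "y \<in> carrier_vec n"
  shows "\<bar>ip x y\<bar> \<le> nrm x * nrm y"
proof (cases "y = 0\<^sub>v n")
  case True
  then show ?thesis using x y by (simp add: ip_simps nrm_nonneg)
next
  case False
  \<comment> \<open>The component of \<open>x\<close> orthogonal to \<open>y\<close>, multiplied by
    \<open>ip y y\<close> to clear the denominator.\<close>
  define z where "z = ip y y \<cdot>\<^sub>v x - ip x y \<cdot>\<^sub>v y"
  have "0 \<le> ip z z" by (rule ip_nonneg) (use x y in \<open>simp add: z_def\<close>)
  also have "ip z z = ip y y * (ip x x * ip y y - (ip x y)\<^sup>2)"
    using x y sym[OF x y] by (simp add: z_def ip_simps algebra_simps power2_eq_square)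
  finally have "(ip x y)\<^sup>2 \<le> ip x x * ip y y"
    using ip_pos[OF y False] by (simp add: zero_le_mult_iff)
  then have "\<bar>ip x y\<bar>\<^sup>2 \<le> (nrm x * nrm y)\<^sup>2"
    using x y by (simp add: power_mult_distrib nrm_sq)
  then show ?thesis by (rule power2_le_imp_le) (simp add: x y nrm_nonneg)
qed

section \<open>Operator norm estimates\<close>

lemma op_bound_nrm:
  assumes "op_bound M c" "M \<in> carrier_mat n n" "x \<in> carrier_vec n"
  shows "nrm (M *\<^sub>v x) \<le> c * nrm x"
proof -
  have Mx: "M *\<^sub>v x \<in> carrier_vec n" using assms by simp
  \<comment> \<open>Testing against \<open>M *\<^sub>v x\<close> itself gives the squared norm on
    the left; one factor cancels unless it is zero.\<close>
  have "\<bar>ip (M *\<^sub>v x) (M *\<^sub>v x)\<bar> \<le> c * nrm x * nrm (M *\<^sub>v x)"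
    using assms Mx unfolding op_bound_def by blast
  then have "nrm (M *\<^sub>v x) * nrm (M *\<^sub>v x) \<le> c * nrm x * nrm (M *\<^sub>v x)"
    using nrm_sq[OF Mx] by (simp add: power2_eq_square)
  then show ?thesis
    using nrm_nonneg[OF Mx] nrm_nonneg[OF assms(3)] assms(1)
    by (cases "nrm (M *\<^sub>v x) = 0") (auto simp: op_bound_def)
qed

lemma op_boundI:
  assumes "M \<in> carrier_mat n n" "0 \<le> c" "\<And>x. x \<in> carrier_vec n \<Longrightarrow> nrm (M *\<^sub>v x) \<le> c * nrm x"
  shows "op_bound M c"
  unfolding op_bound_def
proof (intro conjI ballI)
  fix x y :: "real vec" assume x: "x \<in> carrier_vec n" and y: "y \<in> carrier_vec n"
  have "\<bar>ip (M *\<^sub>v x) y\<bar> \<le> nrm (M *\<^sub>v x) * nrm y" using assms x y by (intro Cauchy_Schwarz) auto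
  also have "\<dots> \<le> c * nrm x * nrm y"
    using assms(3)[OF x] nrm_nonneg[OF y] by (rule mult_right_mono)
  finally show "\<bar>ip (M *\<^sub>v x) y\<bar> \<le> c * nrm x * nrm y" .
qed fact

lemma op_bound_mono:
  assumes "op_bound M c" "c \<le> d"
  shows "op_bound M d"
  unfolding op_bound_def
proof (intro conjI ballI)
  fix x y :: "real vec" assume x: "x \<in> carrier_vec n" and y: "y \<in> carrier_vec n"
  have "\<bar>ip (M *\<^sub>v x) y\<bar> \<le> c * nrm x * nrm y"
    using assms(1) x y by (simp add: op_bound_def)
  also have "\<dots> \<le> d * nrm x * nrm y"
    using assms(2) nrm_nonneg[OF x] nrm_nonneg[OF y] by (intro mult_right_mono)
  finally show "\<bar>ip (M *\<^sub>v x) y\<bar> \<le> d * nrm x * nrm y" .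
qed (use assms in \<open>auto simp: op_bound_def\<close>)

lemma op_bound_mult:
  assumes "op_bound M c" "M \<in> carrier_mat n n" "op_bound N d" "N \<in> carrier_mat n n"
  shows "op_bound (M * N) (c * d)"
proof (rule op_boundI)
  fix x :: "real vec" assume x: "x \<in> carrier_vec n"
  have cd: "0 \<le> c" "0 \<le> d" using assms by (auto simp: op_bound_def)
  have "nrm (M *\<^sub>v (N *\<^sub>v x)) \<le> c * nrm (N *\<^sub>v x)"
    using assms x by (intro op_bound_nrm) auto
  also have "\<dots> \<le> c * (d * nrm x)"
    using cd op_bound_nrm[OF assms(3,4) x] by (intro mult_left_mono)
  finally show "nrm (M * N *\<^sub>v x) \<le> c * d * nrm x" using assms x by (simp add: mult.assoc)
qed (use assms in \<open>auto simp: op_bound_def\<close>)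

lemma op_bound_add:
  assumes "op_bound M c" "M \<in> carrier_mat n n" "op_bound N d" "N \<in> carrier_mat n n"
  shows "op_bound (M + N) (c + d)"
  unfolding op_bound_def
proof (intro conjI ballI)
  fix x y :: "real vec" assume x: "x \<in> carrier_vec n" and y: "y \<in> carrier_vec n"
  have "ip ((M + N) *\<^sub>v x) y = ip (M *\<^sub>v x) y + ip (N *\<^sub>v x) y"
    using assms x y by (simp add: add_mult_distrib_mat_vec[of _ n n] ip_simps)
  moreover have "\<bar>ip (M *\<^sub>v x) y\<bar> \<le> c * nrm x * nrm y" "\<bar>ip (N *\<^sub>v x) y\<bar> \<le> d * nrm x * nrm y"
    using assms x y by (auto simp: op_bound_def)
  ultimately show "\<bar>ip ((M + N) *\<^sub>v x) y\<bar> \<le> (c + d) * nrm x * nrm y" by (simp add: distrib_right)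
qed (use assms in \<open>auto simp: op_bound_def\<close>)

lemma op_bound_smult:
  assumes "op_bound M c" "M \<in> carrier_mat n n"
  shows "op_bound (t \<cdot>\<^sub>m M) (\<bar>t\<bar> * c)"
  unfolding op_bound_def
proof (intro conjI ballI)
  fix x y :: "real vec" assume x: "x \<in> carrier_vec n" and y: "y \<in> carrier_vec n"
  have "\<bar>ip (M *\<^sub>v x) y\<bar> \<le> c * nrm x * nrm y"
    using assms x y by (auto simp: op_bound_def)
  from mult_left_mono[OF this, of "\<bar>t\<bar>"]
  show "\<bar>ip (t \<cdot>\<^sub>m M *\<^sub>v x) y\<bar> \<le> \<bar>t\<bar> * c * nrm x * nrm y"
    using assms x y by (simp add: smult_mat_mult_vec[of _ n n] ip_simps abs_mult mult.assoc)
qed (use assms in \<open>auto simp: op_bound_def\<close>)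

text \<open>Column \<open>b\<close> is the image of a unit vector. The factor
  \<open>nrm (unit_vec n b)\<close> does not depend on \<open>M\<close>, so a geometric operator
  bound stays geometric in each entry.\<close>

lemma op_bound_entry:
  assumes "op_bound M c" "M \<in> carrier_mat n n" "a < n" "b < n"
  shows "\<bar>M $$ (a, b)\<bar> \<le> nrm (unit_vec n b) * c"
proof -
  have "\<bar>(M *\<^sub>v unit_vec n b) $ a\<bar> \<le> nrm (M *\<^sub>v unit_vec n b)"
    using assms by (intro entry_le_nrm) auto
  also have "\<dots> \<le> c * nrm (unit_vec n b)" using assms by (intro op_bound_nrm) auto
  finally show ?thesis using assms by (simp add: mult.commute)
qed

section \<open>Self-adjointness and limits of operators\<close>

lemma self_adjoint_add:
  assumes "self_adjoint M" "M \<in> carrier_mat n n" "self_adjoint N" "N \<in> carrier_mat n n"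
  shows "self_adjoint (M + N)"
  using assms by (simp add: self_adjoint_def add_mult_distrib_mat_vec[of _ n n] ip_simps)

text \<open>A product of two different self-adjoint operators is self-adjoint only if they commute;
  the iteration below forms only squares.\<close>

lemma self_adjoint_square:
  assumes "self_adjoint M" "M \<in> carrier_mat n n"
  shows "self_adjoint (M * M)"
  using assms by (simp add: self_adjoint_def)

lemma self_adjoint_smult:
  assumes "self_adjoint M" "M \<in> carrier_mat n n"
  shows "self_adjoint (t \<cdot>\<^sub>m M)"
  using assms by (simp add: self_adjoint_def smult_mat_mult_vec[of _ n n] ip_simps)

lemma self_adjoint_limit:
  assumes X: "mat_tendsto n X L" and "\<And>k. self_adjoint (X k)"
  shows "self_adjoint L"
  unfolding self_adjoint_def
proof (intro ballI)
  fix x y :: "real vec" assume x: "x \<in> carrier_vec n" and y: "y \<in> carrier_vec n"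
  have c: "X k \<in> carrier_mat n n" "L \<in> carrier_mat n n" for k using X by (auto simp: mat_tendsto_def)
  \<comment> \<open>\<open>mat_tendsto_form\<close> has the matrix in the first argument, so
    symmetry of \<open>ip\<close> first brings it there on both sides.\<close>
  have "ip (X k *\<^sub>v x) y = ip (X k *\<^sub>v y) x" for k
    using assms(2)[of k] x y c(1)[of k] sym[OF x, of "X k *\<^sub>v y"] by (simp add: self_adjoint_def)
  then have "ip (L *\<^sub>v x) y = ip (L *\<^sub>v y) x"
    using mat_tendsto_form[OF X bilinear x y] mat_tendsto_form[OF X bilinear y x] LIMSEQ_unique
    by simp
  then show "ip (L *\<^sub>v x) y = ip x (L *\<^sub>v y)"
    using sym[OF x, of "L *\<^sub>v y"] c y by simp
qed

lemma op_bound_limit: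
  assumes X: "mat_tendsto n X L" and b: "\<And>k. op_bound (X k) c"
  shows "op_bound L c"
  unfolding op_bound_def
proof (intro conjI ballI)
  fix x y :: "real vec" assume x: "x \<in> carrier_vec n" and y: "y \<in> carrier_vec n"
  show "\<bar>ip (L *\<^sub>v x) y\<bar> \<le> c * nrm x * nrm y"
    by (rule LIMSEQ_le_const2[OF tendsto_rabs[OF mat_tendsto_form[OF X bilinear x y]]])
      (use b x y in \<open>auto simp: op_bound_def\<close>)
qed (use b in \<open>auto simp: op_bound_def\<close>)

text \<open>Each entry is, up to its initial value, a partial sum of its increments, and these are
  dominated by a geometric series.\<close>

lemma Cauchy_mat_tendsto:
  assumes c: "\<And>k. X k \<in> carrier_mat n n" and r: "0 \<le> r" "r < 1"
    and b: "\<And>k. op_bound (X (Suc k) - X k) (C * r ^ k)"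
  obtains L where "mat_tendsto n X L"
proof -
  have "convergent (\<lambda>k. X k $$ (a, b))" if ab: "a < n" "b < n" for a b
  proof -
    have "summable (\<lambda>k. X (Suc k) $$ (a, b) - X k $$ (a, b))"
    proof (rule summable_comparison_test')
      show "summable (\<lambda>k. nrm (unit_vec n b) * C * r ^ k)"
        using r by (intro summable_mult summable_geometric) simp
      show "norm (X (Suc k) $$ (a, b) - X k $$ (a, b)) \<le> nrm (unit_vec n b) * C * r ^ k" for k
        using op_bound_entry[OF b minus_carrier_mat[OF c] ab, of k] c[of k] c[of "Suc k"] ab
        by (simp add: mult.assoc)
    qed
    then have "convergent (\<lambda>m. \<Sum>k<m. X (Suc k) $$ (a, b) - X k $$ (a, b))"
      by (rule summable_iff_convergent[THEN iffD1])
    then have "convergent (\<lambda>m. X m $$ (a, b) - X 0 $$ (a, b))" 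
      by (simp add: sum_lessThan_telescope[of "\<lambda>k. X k $$ (a, b)"])
    from convergent_add[OF this convergent_const[of "X 0 $$ (a, b)"]] show ?thesis by simp
  qed
  then have "mat_tendsto n X (mat n n (\<lambda>(a, b). lim (\<lambda>k. X k $$ (a, b))))"
    using c by (simp add: mat_tendsto_def convergent_LIMSEQ_iff)
  then show ?thesis by (rule that)
qed

text \<open>\<open>1 - Y\<close> is a square root of \<open>1 - B\<close> iff \<open>Y = (B + Y\<^sup>2) / 2\<close>, and the right-hand side is a
  contraction of the operators of norm at most \<open>r\<close>.\<close>

lemma square_root_exists:
  assumes B: "B \<in> carrier_mat n n" and sa: "self_adjoint B"
    and bd: "op_bound B r" and r: "r < 1"
  obtains S where "S \<in> carrier_mat n n" "S * S = 1\<^sub>m n - B" "self_adjoint S"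
    "\<And>x. x \<in> carrier_vec n \<Longrightarrow> (1 - r) * ip x x \<le> ip (S *\<^sub>v x) x"
    "\<And>M. M \<in> carrier_mat n n \<Longrightarrow> M * B = B * M \<Longrightarrow> M * S = S * M"
proof -
  have r0: "0 \<le> r" using bd by (simp add: op_bound_def)
  \<comment> \<open>Starting at 0 makes every iterate a polynomial in \<open>B\<close>, so
    self-adjointness and commutation with whatever commutes with \<open>B\<close> follow by
    induction.\<close>
  define Y where "Y = rec_nat (0\<^sub>m n n) (\<lambda>_ Z. (1/2) \<cdot>\<^sub>m (B + Z * Z))"
  have z: "0\<^sub>m n n *\<^sub>v x = (0\<^sub>v n :: real vec)" if "x \<in> carrier_vec n" for x
    using that by (intro eq_vecI) auto
  have Y0: "Y 0 = 0\<^sub>m n n" and YS: "Y (Suc k) = (1/2) \<cdot>\<^sub>m (B + Y k * Y k)" for k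
    by (simp_all add: Y_def)
  have Yc [simp]: "Y k \<in> carrier_mat n n" for k
    by (induction k) (use B in \<open>auto simp: Y0 YS\<close>)
  have Ysa: "self_adjoint (Y k)" for k
  proof (induction k)
    case 0 show ?case by (simp add: Y0 self_adjoint_def ip_simps z)
  next
    case (Suc k) then show ?case using B sa unfolding YS
      by (intro self_adjoint_smult self_adjoint_add self_adjoint_square) auto
  qed
  have Yb: "op_bound (Y k) r" for k
  proof (induction k)
    case 0 show ?case using r0 by (auto simp: Y0 op_bound_def ip_simps nrm_nonneg z)
  next
    case (Suc k)
    have "op_bound (Y (Suc k)) (\<bar>1/2\<bar> * (r + r * r))" unfolding YS
      using B bd Suc by (intro op_bound_smult op_bound_add op_bound_mult) auto
    moreover have "\<bar>1/2\<bar> * (r + r * r) \<le> r" using r r0 mult_left_le[of r r] by simp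
    ultimately show ?case by (rule op_bound_mono)
  qed
  have Yd: "op_bound (Y (Suc k) - Y k) (r * r ^ k)" for k
  proof (induction k)
    case 0
    have "M - 0\<^sub>m n n = M" if "M \<in> carrier_mat n n" for M :: "real mat"
      using that by (intro eq_matI) auto
    then have "Y (Suc 0) - Y 0 = Y 1" by (simp add: Y0)
    then show ?case using Yb[of 1] by simp
  next
    case (Suc k)
    define D where "D = Y (Suc k) - Y k"
    have D: "D \<in> carrier_mat n n" by (simp add: D_def minus_carrier_mat)
    \<comment> \<open>A difference of squares without commutation: P^2 - Q^2 = P(P - Q) + (P - Q)Q,
      by inserting the mixed product PQ. Both iterates are bounded by \<open>r\<close>, so half the
      sum shrinks the increment \<open>D\<close> by the factor \<open>r\<close>.\<close>
    have "Y (Suc (Suc k)) - Y (Suc k) = (1/2) \<cdot>\<^sub>m (Y (Suc k) * D + D * Y k)"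
    proof -
      have arith: "(1/2) \<cdot>\<^sub>m (B + P) - (1/2) \<cdot>\<^sub>m (B + R) = (1/2) \<cdot>\<^sub>m ((P - Q) + (Q - R))"
        if "P \<in> carrier_mat n n" "Q \<in> carrier_mat n n" "R \<in> carrier_mat n n" for P Q R
        using that B by (intro eq_matI) (auto simp: field_simps)
      have "Y (Suc k) * D = Y (Suc k) * Y (Suc k) - Y (Suc k) * Y k"
        "D * Y k = Y (Suc k) * Y k - Y k * Y k"
        unfolding D_def
        by (rule mult_minus_distrib_mat[OF Yc Yc Yc] minus_mult_distrib_mat[OF Yc Yc Yc])+
      moreover have "Y (Suc (Suc k)) - Y (Suc k) =
          (1/2) \<cdot>\<^sub>m (B + Y (Suc k) * Y (Suc k)) - (1/2) \<cdot>\<^sub>m (B + Y k * Y k)"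
        by (rule arg_cong2[where f = "(-)"]; rule YS)
      moreover have "\<dots> = (1/2) \<cdot>\<^sub>m ((Y (Suc k) * Y (Suc k) - Y (Suc k) * Y k)
          + (Y (Suc k) * Y k - Y k * Y k))"
        by (rule arith) simp_all
      ultimately show ?thesis by (simp only:)
    qed
    moreover have "op_bound \<dots> (\<bar>1/2\<bar> * (r * (r * r ^ k) + (r * r ^ k) * r))"
      using D Yb Suc by (intro op_bound_smult op_bound_add op_bound_mult) (auto simp: D_def)
    ultimately show ?case by (simp add: mult_ac)
  qed
  obtain L where L: "mat_tendsto n Y L"
    using Cauchy_mat_tendsto[OF Yc r0 r Yd] by blast
  have Lc: "L \<in> carrier_mat n n" using L by (simp add: mat_tendsto_def)
  \<comment> \<open>The shifted sequence has the same limit, so the recursion turns into the fixed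
    point equation for \<open>L\<close>.\<close>
  have "mat_tendsto n (\<lambda>k. Y (Suc k)) ((1/2) \<cdot>\<^sub>m (B + L * L))"
    unfolding YS using L B
    by (intro mat_tendsto_smult mat_tendsto_add mat_tendsto_mult mat_tendsto_const)
  from mat_tendsto_unique[OF mat_tendsto_Suc[OF L] this]
  have fix_L: "L = (1/2) \<cdot>\<^sub>m (B + L * L)" .
  define S where "S = 1\<^sub>m n - L"
  have Sc: "S \<in> carrier_mat n n" using Lc by (simp add: S_def minus_carrier_mat)
  have Sx: "S *\<^sub>v x = x - L *\<^sub>v x" if "x \<in> carrier_vec n" for x
    unfolding S_def using Lc that by (subst minus_mult_distrib_mat_vec[of _ n n]) auto
  have "S * S = 1\<^sub>m n - B"
  proof -
    \<comment> \<open>Here \<open>M\<close> stands for \<open>L\<close> and \<open>P\<close> for its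
      square. Then (1 - L)^2 = 1 - 2L + L^2, and the fixed point equation says 2L = B + L^2.\<close>
    have arith: "1\<^sub>m n - M - (M - P) = 1\<^sub>m n - B"
      if "P \<in> carrier_mat n n" "M \<in> carrier_mat n n" "M = (1/2) \<cdot>\<^sub>m (B + P)" for P M
      using that(1,2) B unfolding that(3) by (intro eq_matI) (auto simp: field_simps)
    have "S * S = 1\<^sub>m n * S - L * S"
      unfolding S_def by (rule minus_mult_distrib_mat) (use Lc Sc in \<open>auto simp: S_def\<close>)
    also have "L * S = L * 1\<^sub>m n - L * L"
      unfolding S_def by (rule mult_minus_distrib_mat) (use Lc in auto)
    also have "1\<^sub>m n * S - (L * 1\<^sub>m n - L * L) = 1\<^sub>m n - L - (L - L * L)"
      using Sc Lc by (simp add: S_def)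
    also have "\<dots> = 1\<^sub>m n - B" by (rule arith[OF _ Lc fix_L]) (simp add: Lc)
    finally show ?thesis .
  qed
  moreover have "self_adjoint S"
    using self_adjoint_limit[OF L Ysa] Lc
    by (simp add: self_adjoint_def Sx ip_simps)
  \<comment> \<open>Since \<open>L\<close> is bounded by \<open>r\<close>, subtracting it from the
    identity leaves at least the fraction \<open>1 - r\<close>; this makes \<open>S\<close> the
    positive root.\<close>
  moreover have "(1 - r) * ip x x \<le> ip (S *\<^sub>v x) x" if x: "x \<in> carrier_vec n" for x
  proof -
    have "\<bar>ip (L *\<^sub>v x) x\<bar> \<le> r * nrm x * nrm x"
      using op_bound_limit[OF L Yb] x by (simp add: op_bound_def)
    then show ?thesis
      using x Lc nrm_sq[OF x] by (simp add: Sx ip_simps power2_eq_square algebra_simps)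
  qed
  moreover have "M * S = S * M" if M: "M \<in> carrier_mat n n" and MB: "M * B = B * M" for M
  proof -
    have "M * Y k = Y k * M" for k
    proof (induction k)
      case 0 show ?case using M by (simp add: Y0)
    next
      case (Suc k)
      have "M * (Y k * Y k) = (M * Y k) * Y k" using M by (simp add: assoc_mult_mat[of _ n n _ n _ n])
      also have "\<dots> = (Y k * Y k) * M" using M
        by (simp add: Suc) (simp add: assoc_mult_mat[of _ n n _ n _ n] Suc)
      finally show ?case using M B
        by (simp add: YS mult_smult_distrib[of _ n n _ n] mult_smult_assoc_mat[of _ n n _ n]
          mult_add_distrib_mat[of _ n n _ n] add_mult_distrib_mat[of _ n n _ _ n] MB)
    qed
    then have "mat_tendsto n (\<lambda>k. M * Y k) (L * M)"
      using mat_tendsto_mult[OF L mat_tendsto_const[OF M]] by simp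
    then have "M * L = L * M"
      using mat_tendsto_unique mat_tendsto_mult[OF mat_tendsto_const[OF M] L] by blast
    then show ?thesis using M Lc
      by (simp add: S_def mult_minus_distrib_mat[of _ n n _ n] minus_mult_distrib_mat[of _ n n _ _ n])
  qed
  ultimately show ?thesis using Sc that by blast
qed

section \<open>Operators that represent forms, and their bounds\<close>

lemma riesz:
  assumes "bilinear_form n \<beta>"
  obtains A where "A \<in> carrier_mat n n"
    "\<And>x y. x \<in> carrier_vec n \<Longrightarrow> y \<in> carrier_vec n \<Longrightarrow> \<beta> x y = ip x (A *\<^sub>v y)"
proof -
  \<comment> \<open>Positive definiteness makes the Gram matrix of \<open>ip\<close> invertible: a
    kernel vector has \<open>ip x x = 0\<close>.\<close>
  have "x = 0\<^sub>v n" if x: "x \<in> carrier_vec n" and "gram_mat n ip *\<^sub>v x = 0\<^sub>v n" for x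
    using that gram_mat[OF bilinear x x] ip_eq_0[OF x] by simp
  then obtain H where H: "H \<in> carrier_mat n n" "gram_mat n ip * H = 1\<^sub>m n"
    using trivial_kernel_inverse[OF gram_mat_carrier] by blast
  \<comment> \<open>In coordinates the requirement is that the Gram matrix of \<open>ip\<close>
    times \<open>A\<close> be the Gram matrix of \<open>\<beta>\<close>; \<open>H\<close> inverts
    the former.\<close>
  define A where "A = H * gram_mat n \<beta>"
  have A: "A \<in> carrier_mat n n" using H by (simp add: A_def)
  have "\<beta> x y = ip x (A *\<^sub>v y)" if x: "x \<in> carrier_vec n" and y: "y \<in> carrier_vec n" for x y
  proof -
    have "ip x (A *\<^sub>v y) = x \<bullet> (gram_mat n ip *\<^sub>v (A *\<^sub>v y))"
      using A x y by (intro gram_mat[OF bilinear]) auto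
    also have "gram_mat n ip *\<^sub>v (A *\<^sub>v y) = (gram_mat n ip * H) *\<^sub>v (gram_mat n \<beta> *\<^sub>v y)"
      using H(1) y by (simp add: A_def assoc_mult_mat_vec[of _ n n _ n])
    also have "\<dots> = gram_mat n \<beta> *\<^sub>v y"
      unfolding H(2) by (rule one_mult_mat_vec) (simp add: y)
    finally show ?thesis using gram_mat[OF assms x y] by simp
  qed
  with A show ?thesis by (rule that)
qed

text \<open>The left side is the quadratic form of a bilinear form, hence at most a multiple of
  \<open>x \<bullet> x\<close>, which \<open>ip\<close> dominates.\<close>

lemma mult_vec_bound:
  assumes "M \<in> carrier_mat n n"
  obtains K where "K > 0" "\<And>x. x \<in> carrier_vec n \<Longrightarrow> ip (M *\<^sub>v x) (M *\<^sub>v x) \<le> K * ip x x"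
proof -
  from bilinear_form_bound[OF bilinear_form_compose[OF bilinear assms assms]]
  obtain K where K: "K > 0" "\<And>x. x \<in> carrier_vec n \<Longrightarrow> \<bar>ip (M *\<^sub>v x) (M *\<^sub>v x)\<bar> \<le> K * (x \<bullet> x)"
    by blast
  have "ip (M *\<^sub>v x) (M *\<^sub>v x) \<le> K * ip x x" if x: "x \<in> carrier_vec n" for x
    using K(2)[OF x] mult_left_mono[OF dominating[OF x], of K] K(1) by linarith
  with K(1) show ?thesis by (rule that)
qed

text \<open>Write \<open>\<omega>(x, y) = ip x (A y)\<close> with \<open>A\<close> skew and invertible. In the polar decomposition of
  \<open>A\<close> with respect to \<open>ip\<close>, the positive part is \<open>\<surd>(-A\<^sup>2)\<close> and the orthogonal part is, up to
  sign, the required complex structure. The rescaling by \<open>c\<close> makes \<open>1 + cA\<^sup>2\<close> a strict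
  contraction.\<close>

lemma compatible_complex_structure:
  assumes alt: "alternating_form n \<omega>"
    and nondeg: "\<And>x. x \<in> carrier_vec n \<Longrightarrow> (\<And>y. y \<in> carrier_vec n \<Longrightarrow> \<omega> y x = 0) \<Longrightarrow> x = 0\<^sub>v n"
  obtains J where "complex_structure n J"
    "\<And>x y. x \<in> carrier_vec n \<Longrightarrow> y \<in> carrier_vec n \<Longrightarrow> \<omega> (J *\<^sub>v x) (J *\<^sub>v y) = \<omega> x y"
    "\<And>x. x \<in> carrier_vec n \<Longrightarrow> x \<noteq> 0\<^sub>v n \<Longrightarrow> \<omega> (J *\<^sub>v x) x > 0"
    "\<And>M N. M \<in> carrier_mat n n \<Longrightarrow> N \<in> carrier_mat n n \<Longrightarrow> M * N = 1\<^sub>m n \<Longrightarrow>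
       (\<And>x y. x \<in> carrier_vec n \<Longrightarrow> y \<in> carrier_vec n \<Longrightarrow> ip (M *\<^sub>v x) (M *\<^sub>v y) = ip x y) \<Longrightarrow>
       (\<And>x y. x \<in> carrier_vec n \<Longrightarrow> y \<in> carrier_vec n \<Longrightarrow> \<omega> (M *\<^sub>v x) (M *\<^sub>v y) = \<omega> x y) \<Longrightarrow>
       M * J = J * M"
proof -
  have bil: "bilinear_form n \<omega>" using alt by (simp add: alternating_form_iff)
  have assoc: "(M * N) *\<^sub>v x = M *\<^sub>v (N *\<^sub>v x)"
    if "M \<in> carrier_mat n n" "N \<in> carrier_mat n n" "x \<in> carrier_vec n" for M N and x :: "real vec"
    using that by simp
  have commute: "M * N = N * M \<longleftrightarrow> (\<forall>x\<in>carrier_vec n. M *\<^sub>v (N *\<^sub>v x) = N *\<^sub>v (M *\<^sub>v x))"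
    if "M \<in> carrier_mat n n" "N \<in> carrier_mat n n" for M N :: "real mat"
  proof
    assume MN: "M * N = N * M"
    show "\<forall>x\<in>carrier_vec n. M *\<^sub>v (N *\<^sub>v x) = N *\<^sub>v (M *\<^sub>v x)"
      using arg_cong[OF MN, of "\<lambda>L. L *\<^sub>v _"] assoc that by metis
  next
    assume "\<forall>x\<in>carrier_vec n. M *\<^sub>v (N *\<^sub>v x) = N *\<^sub>v (M *\<^sub>v x)"
    then show "M * N = N * M"
      using that by (intro mat_eq_if_mult_vec_eq) (auto simp: assoc)
  qed
  obtain A where A [simp]: "A \<in> carrier_mat n n"
    and \<omega>: "\<And>x y. x \<in> carrier_vec n \<Longrightarrow> y \<in> carrier_vec n \<Longrightarrow> \<omega> x y = ip x (A *\<^sub>v y)"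
    using riesz[OF bil] by blast
  have skew: "ip x (A *\<^sub>v y) = - ip (A *\<^sub>v x) y"
    if x: "x \<in> carrier_vec n" and y: "y \<in> carrier_vec n" for x y
    using alternating_form_skew[OF alt x y] \<omega> x y sym[OF y, of "A *\<^sub>v x"] by simp
  have "x = 0\<^sub>v n" if x: "x \<in> carrier_vec n" and "A *\<^sub>v x = 0\<^sub>v n" for x
    by (rule nondeg[OF x]) (use that \<omega> in \<open>simp add: ip_simps(10)\<close>)
  then obtain C where C [simp]: "C \<in> carrier_mat n n" and ACm: "A * C = 1\<^sub>m n" "C * A = 1\<^sub>m n"
    using trivial_kernel_inverse[OF A] by blast
  have AC: "A *\<^sub>v (C *\<^sub>v x) = x" and CA: "C *\<^sub>v (A *\<^sub>v x) = x" if "x \<in> carrier_vec n" for x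
    using that ACm by (simp_all flip: assoc)
  obtain K where K: "K > 0" "\<And>x. x \<in> carrier_vec n \<Longrightarrow> ip (A *\<^sub>v x) (A *\<^sub>v x) \<le> K * ip x x"
    using mult_vec_bound[OF A] by blast
  obtain K' where K': "K' > 0" "\<And>x. x \<in> carrier_vec n \<Longrightarrow> ip (C *\<^sub>v x) (C *\<^sub>v x) \<le> K' * ip x x"
    using mult_vec_bound[OF C] by blast
  \<comment> \<open>Since |Ax|^2 <= K |x|^2 and |x|^2 <= K' |Ax|^2, the quadratic form |x|^2 -
    c|Ax|^2 of \<open>B\<close> lies between 0 and (1 - c/K')|x|^2. The matrix 1 - B = -cA^2 is the
    one whose root is wanted, up to scale.\<close>
  define c where "c = 1 / K"
  have c: "c > 0" "c * K = 1" using K(1) by (simp_all add: c_def)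
  define B where "B = 1\<^sub>m n + c \<cdot>\<^sub>m (A * A)"
  have B [simp]: "B \<in> carrier_mat n n" by (simp add: B_def)
  have Bx: "B *\<^sub>v x = x + c \<cdot>\<^sub>v (A *\<^sub>v (A *\<^sub>v x))" if "x \<in> carrier_vec n" for x
    using that
    by (simp add: B_def add_mult_distrib_mat_vec[of _ n n] smult_mat_mult_vec[of _ n n] assoc)
  have sB: "self_adjoint B"
    unfolding self_adjoint_def by (simp add: Bx ip_simps skew)
  \<comment> \<open>A nonzero vector would force \<open>K * K'\<close> to be at least 1 and hence
    \<open>1 - c / K'\<close> to be nonnegative; the maximum covers dimension 0, where
    \<open>K\<close> and \<open>K'\<close> are arbitrary positive numbers.\<close>
  define q where "q = max 0 (1 - c / K')"
  have q: "0 \<le> q" "q < 1" using c(1) K'(1) by (auto simp: q_def)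
  have "op_bound B (sqrt q)"
  proof (rule op_boundI)
    fix x :: "real vec" assume x: "x \<in> carrier_vec n"
    define a where "a = ip (A *\<^sub>v x) (A *\<^sub>v x)"
    have le: "ip (A *\<^sub>v (A *\<^sub>v x)) (A *\<^sub>v (A *\<^sub>v x)) \<le> K * a"
      using K(2)[of "A *\<^sub>v x"] x by (simp add: a_def)
    have ge: "ip x x \<le> K' * a"
      using K'(2)[of "A *\<^sub>v x"] x by (simp add: a_def CA)
    \<comment> \<open>Skewness turns the cross term into \<open>- 2 * c * a\<close>. As
      \<open>c * K = 1\<close>, the quartic term gives back at most one \<open>c * a\<close>, and
      the bound on the inverse \<open>C\<close> controls the one that is left.\<close>
    have "ip (B *\<^sub>v x) (B *\<^sub>v x) =
        ip x x - 2 * c * a + c * (c * ip (A *\<^sub>v (A *\<^sub>v x)) (A *\<^sub>v (A *\<^sub>v x)))"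
      using x sym[of "A *\<^sub>v (A *\<^sub>v x)" x] by (simp add: Bx ip_simps skew[of x] a_def algebra_simps)
    also have "\<dots> \<le> ip x x - 2 * c * a + c * (c * (K * a))"
      using le c(1) by (intro add_left_mono mult_left_mono) auto
    also have "\<dots> = ip x x - c * a" using c(2) by (simp add: algebra_simps)
    also have "c / K' * ip x x \<le> c * a"
      using ge c(1) K'(1) by (simp add: field_simps)
    then have "ip x x - c * a \<le> (1 - c / K') * ip x x" by (simp add: algebra_simps)
    also have "\<dots> \<le> q * ip x x" by (intro mult_right_mono ip_nonneg x) (simp add: q_def)
    finally show "nrm (B *\<^sub>v x) \<le> sqrt q * nrm x"
      by (simp add: nrm_def flip: real_sqrt_mult)
  qed (use q in auto)
  moreover have "sqrt q < 1" using q by simp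
  ultimately obtain S where S [simp]: "S \<in> carrier_mat n n" and SSm: "S * S = 1\<^sub>m n - B"
    and sS: "self_adjoint S"
    and Spos: "\<And>x. x \<in> carrier_vec n \<Longrightarrow> (1 - sqrt q) * ip x x \<le> ip (S *\<^sub>v x) x"
    and Scomm: "\<And>M. M \<in> carrier_mat n n \<Longrightarrow> M * B = B * M \<Longrightarrow> M * S = S * M"
    using square_root_exists[OF B sB] by blast
  have SS: "S *\<^sub>v (S *\<^sub>v x) = - (c \<cdot>\<^sub>v (A *\<^sub>v (A *\<^sub>v x)))" if x: "x \<in> carrier_vec n" for x
  proof -
    have "S *\<^sub>v (S *\<^sub>v x) = (1\<^sub>m n - B) *\<^sub>v x" using x by (simp flip: assoc SSm)
    also have "\<dots> = x - B *\<^sub>v x" using x by (subst minus_mult_distrib_mat_vec[of _ n n]) auto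
    also have "\<dots> = - (c \<cdot>\<^sub>v (A *\<^sub>v (A *\<^sub>v x)))" using x unfolding Bx[OF x]
      by (intro eq_vecI) (auto simp del: index_mult_mat_vec)
    finally show ?thesis .
  qed
  \<comment> \<open>\<open>B\<close> is a polynomial in \<open>A\<close>, so commuting with
    \<open>A\<close> is enough. This is used for the inverse \<open>C\<close> and for the isometries
    \<open>M\<close> that preserve \<open>\<omega>\<close>.\<close>
  have commS: "M *\<^sub>v (S *\<^sub>v x) = S *\<^sub>v (M *\<^sub>v x)"
    if M: "M \<in> carrier_mat n n" and MA: "\<And>x. x \<in> carrier_vec n \<Longrightarrow> M *\<^sub>v (A *\<^sub>v x) = A *\<^sub>v (M *\<^sub>v x)"
      and x: "x \<in> carrier_vec n" for M x
  proof -
    have "M *\<^sub>v (B *\<^sub>v x) = B *\<^sub>v (M *\<^sub>v x)" if "x \<in> carrier_vec n" for x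
      using that M
      by (simp add: Bx mult_add_distrib_mat_vec[of _ n n] mult_mat_vec_smult[of _ n n] MA)
    then have "M * S = S * M" using commute[OF M B] M by (intro Scomm) auto
    then show ?thesis using commute[OF M S] x by blast
  qed
  have CS: "C *\<^sub>v (S *\<^sub>v x) = S *\<^sub>v (C *\<^sub>v x)" if "x \<in> carrier_vec n" for x
    by (rule commS) (simp_all add: AC CA that)
  \<comment> \<open>\<open>S\<close> is the positive root of -cA^2; as s^2 c = 1, the multiple sS is
    the positive root of -A^2 and the rescaling is undone.\<close>
  define s where "s = sqrt K"
  have s: "s > 0" "s * (s * c) = 1"
  proof -
    show "s > 0" using K(1) by (simp add: s_def)
    have "s * s = K" using K(1) by (simp add: s_def)
    then show "s * (s * c) = 1" using c(2) by (metis mult.assoc mult.commute)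
  qed
  \<comment> \<open>The sign is forced by positivity: skewness gives \<omega>(Jx, x) = -ip(AJx, x),
    and AJ = -sS.\<close>
  define J where "J = (- s) \<cdot>\<^sub>m (C * S)"
  have J [simp]: "J \<in> carrier_mat n n" by (simp add: J_def)
  have Jx: "J *\<^sub>v x = (- s) \<cdot>\<^sub>v (C *\<^sub>v (S *\<^sub>v x))" if "x \<in> carrier_vec n" for x
    using that by (simp add: J_def smult_mat_mult_vec[of _ n n] assoc)
  have CSS: "C *\<^sub>v (S *\<^sub>v (S *\<^sub>v x)) = (- c) \<cdot>\<^sub>v (A *\<^sub>v x)" if x: "x \<in> carrier_vec n" for x
  proof -
    have "- (c \<cdot>\<^sub>v (A *\<^sub>v (A *\<^sub>v x))) = (- c) \<cdot>\<^sub>v (A *\<^sub>v (A *\<^sub>v x))" by auto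
    then show ?thesis using x by (simp add: SS mult_mat_vec_smult[of _ n n] CA)
  qed
  have "J * J = - 1\<^sub>m n"
  proof (rule mat_eq_if_mult_vec_eq)
    fix x :: "real vec" assume x: "x \<in> carrier_vec n"
    have "J *\<^sub>v (J *\<^sub>v x) = (s * s) \<cdot>\<^sub>v (C *\<^sub>v (C *\<^sub>v (S *\<^sub>v (S *\<^sub>v x))))"
      using x by (simp add: Jx mult_mat_vec_smult[of _ n n] smult_smult_assoc CS)
    also have "\<dots> = (s * s * - c) \<cdot>\<^sub>v x"
      using x by (simp add: CSS mult_mat_vec_smult[of _ n n] smult_smult_assoc CA)
    also have "s * s * - c = - 1" using s(2) by (simp add: mult.assoc)
    also have "- 1 \<cdot>\<^sub>v x = - x" by auto
    finally show "J * J *\<^sub>v x = - 1\<^sub>m n *\<^sub>v x" using x by (simp add: assoc uminus_mult_mat_vec)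
  qed auto
  then have 1: "complex_structure n J" by (simp add: complex_structure_def)
  have 2: "\<omega> (J *\<^sub>v x) (J *\<^sub>v y) = \<omega> x y" if x: "x \<in> carrier_vec n" and y: "y \<in> carrier_vec n" for x y
  proof -
    have "\<omega> (J *\<^sub>v x) (J *\<^sub>v y) = s * s * ip (C *\<^sub>v (S *\<^sub>v x)) (S *\<^sub>v y)"
      using x y by (simp add: \<omega> Jx ip_simps mult_mat_vec_smult[of _ n n] AC mult.assoc)
    \<comment> \<open>Self-adjointness moves \<open>S\<close> to the left, where C S^2 = -cA;
      skewness of \<open>A\<close> then absorbs the minus sign.\<close>
    also have "ip (C *\<^sub>v (S *\<^sub>v x)) (S *\<^sub>v y) = ip (C *\<^sub>v (S *\<^sub>v (S *\<^sub>v x))) y"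
      using sS x y by (simp add: self_adjoint_def CS)
    also have "\<dots> = c * ip x (A *\<^sub>v y)"
      using x y by (simp add: CSS ip_simps skew)
    finally show ?thesis using s(2) x y by (simp add: \<omega> mult.assoc)
  qed
  have 3: "\<omega> (J *\<^sub>v x) x > 0" if x: "x \<in> carrier_vec n" and x0: "x \<noteq> 0\<^sub>v n" for x
  proof -
    have "\<omega> (J *\<^sub>v x) x = s * ip (S *\<^sub>v x) x"
      using x by (simp add: \<omega> Jx ip_simps skew AC mult_mat_vec_smult[of _ n n])
    moreover have "0 < (1 - sqrt q) * ip x x"
      using \<open>sqrt q < 1\<close> ip_pos[OF x x0] by simp
    ultimately show ?thesis using s(1) Spos[OF x] by simp
  qed
  have 4: "M * J = J * M"
    if M [simp]: "M \<in> carrier_mat n n" and N [simp]: "N \<in> carrier_mat n n" and MN: "M * N = 1\<^sub>m n"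
      and ipM: "\<And>x y. x \<in> carrier_vec n \<Longrightarrow> y \<in> carrier_vec n \<Longrightarrow> ip (M *\<^sub>v x) (M *\<^sub>v y) = ip x y"
      and \<omega>M: "\<And>x y. x \<in> carrier_vec n \<Longrightarrow> y \<in> carrier_vec n \<Longrightarrow> \<omega> (M *\<^sub>v x) (M *\<^sub>v y) = \<omega> x y"
    for M N
  proof -
    have MA: "M *\<^sub>v (A *\<^sub>v y) = A *\<^sub>v (M *\<^sub>v y)" if y: "y \<in> carrier_vec n" for y
    proof -
      \<comment> \<open>The defect is tested against itself. Writing \<open>d\<close> as
        \<open>M *\<^sub>v (N *\<^sub>v d)\<close> lets both invariances apply, and they show that
        \<open>d\<close> has the same product with each of the two vectors whose difference it
        is.\<close>
      define d where "d = M *\<^sub>v (A *\<^sub>v y) - A *\<^sub>v (M *\<^sub>v y)"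
      have d [simp]: "d \<in> carrier_vec n" using y by (simp add: d_def)
      have dN: "d = M *\<^sub>v (N *\<^sub>v d)" using MN by (simp flip: assoc)
      have "ip d (A *\<^sub>v (M *\<^sub>v y)) = ip d (M *\<^sub>v (A *\<^sub>v y))"
        using y \<omega>M[of "N *\<^sub>v d" y] ipM[of "N *\<^sub>v d" "A *\<^sub>v y"] by (simp add: \<omega> flip: dN)
      then have "ip d d = 0"
        using y by (subst (2) d_def) (simp add: ip_simps)
      then have "d = 0\<^sub>v n" by (simp add: ip_eq_0)
      then show ?thesis
        unfolding d_def by (rule vec_eq_if_diff_eq_0[rotated 2]) (simp_all add: y)
    qed
    have MC: "M *\<^sub>v (C *\<^sub>v y) = C *\<^sub>v (M *\<^sub>v y)" if y: "y \<in> carrier_vec n" for y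
      using MA[of "C *\<^sub>v y"] y CA[of "M *\<^sub>v (C *\<^sub>v y)"] by (simp add: AC)
    show ?thesis
      unfolding commute[OF M J]
      by (simp add: Jx mult_mat_vec_smult[of _ n n] MC commS[OF M MA])
  qed
  from 1 2 3 4 show ?thesis by (rule that)
qed

end


subsection \<open>Averaging forms over a finite group\<close>

text \<open>Deliberately not divided by the group order: division would spoil integrality, and the
  full summand at the identity makes the averaged inner product dominate the standard one.\<close>

definition average_form ::
  "('c, 'd) monoid_scheme \<Rightarrow> ('c \<Rightarrow> 'a::comm_ring_1 mat) \<Rightarrow> ('a vec \<Rightarrow> 'a vec \<Rightarrow> 'a) \<Rightarrow>
     'a vec \<Rightarrow> 'a vec \<Rightarrow> 'a" where
  "average_form G R \<beta> x y = (\<Sum>g\<in>carrier G. \<beta> (R g *\<^sub>v x) (R g *\<^sub>v y))"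

lemma bilinear_form_average:
  assumes "bilinear_form n \<beta>" "\<And>g. g \<in> carrier G \<Longrightarrow> R g \<in> carrier_mat n n"
  shows "bilinear_form n (average_form G R \<beta>)"
  unfolding average_form_def
  by (intro bilinear_form_sum bilinear_form_compose assms)

text \<open>Right translation by \<open>h\<close> permutes the summands.\<close>

lemma average_form_invariant:
  assumes "group G" and h: "h \<in> carrier G"
    and R: "\<And>g. g \<in> carrier G \<Longrightarrow> R g \<in> carrier_mat n n"
    and mult: "\<And>g h. g \<in> carrier G \<Longrightarrow> h \<in> carrier G \<Longrightarrow> R (g \<otimes>\<^bsub>G\<^esub> h) = R g * R h"
    and x: "x \<in> carrier_vec n" and y: "y \<in> carrier_vec n"
  shows "average_form G R \<beta> (R h *\<^sub>v x) (R h *\<^sub>v y) = average_form G R \<beta> x y"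
proof -
  interpret group G by fact
  have *: "R g *\<^sub>v (R h *\<^sub>v z) = R (g \<otimes>\<^bsub>G\<^esub> h) *\<^sub>v z" if "g \<in> carrier G" "z \<in> carrier_vec n" for g z
    using that h R[OF that(1)] R[OF h] by (simp add: mult assoc_mult_mat_vec[of _ n n _ n])
  show ?thesis
    unfolding average_form_def using h x y
    by (intro sum.reindex_bij_witness[where i = "\<lambda>g. g \<otimes>\<^bsub>G\<^esub> inv\<^bsub>G\<^esub> h" and j = "\<lambda>g. g \<otimes>\<^bsub>G\<^esub> h"])
      (auto simp: m_assoc *)
qed


subsection \<open>Integral forms and their real extensions\<close>

lemma bilinear_form_eqI:
  assumes "bilinear_form n \<beta>" "bilinear_form n \<gamma>"
    and "\<And>a b. a < n \<Longrightarrow> b < n \<Longrightarrow> \<beta> (unit_vec n a) (unit_vec n b) = \<gamma> (unit_vec n a) (unit_vec n b)"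
    and "x \<in> carrier_vec n" "y \<in> carrier_vec n"
  shows "\<beta> x y = \<gamma> x y"
proof -
  have "gram_mat n \<beta> = gram_mat n \<gamma>" using assms(3) by (auto simp: gram_mat_def)
  then show ?thesis using gram_mat assms by metis
qed

lemma real_vec_unit: "real_vec (unit_vec n a) = unit_vec n a"
  by (auto simp: unit_vec_def)

lemma real_vec_add: "x \<in> carrier_vec n \<Longrightarrow> y \<in> carrier_vec n \<Longrightarrow> real_vec (x + y) = real_vec x + real_vec y"
  by auto

lemma real_vec_mult: "M \<in> carrier_mat n n \<Longrightarrow> x \<in> carrier_vec n \<Longrightarrow>
    real_mat M *\<^sub>v real_vec x = real_vec (M *\<^sub>v x)"
  by (rule of_int_hom.mult_mat_vec_hom[symmetric])

definition real_extension :: "nat \<Rightarrow> (int vec \<Rightarrow> int vec \<Rightarrow> int) \<Rightarrow> real vec \<Rightarrow> real vec \<Rightarrow> real" where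
  "real_extension n \<omega> x y = x \<bullet> (real_mat (gram_mat n \<omega>) *\<^sub>v y)"

lemma bilinear_form_real_extension: "bilinear_form n (real_extension n \<omega>)"
proof -
  have "bilinear_form n (\<lambda>x y. (1\<^sub>m n *\<^sub>v x) \<bullet> (real_mat (gram_mat n \<omega>) *\<^sub>v y))"
    by (intro bilinear_form_compose bilinear_form_scalar_prod) auto
  then show ?thesis by (simp add: bilinear_form_def real_extension_def)
qed

lemma real_extension:
  assumes "bilinear_form n \<omega>" "x \<in> carrier_vec n" "y \<in> carrier_vec n"
  shows "real_extension n \<omega> (real_vec x) (real_vec y) = of_int (\<omega> x y)"
proof -
  have "real_vec x \<bullet> real_vec z = of_int (x \<bullet> z)" if "z \<in> carrier_vec n" for z
    using assms(2) that by (simp add: scalar_prod_def)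
  then show ?thesis
    using assms by (simp add: real_extension_def real_vec_mult[of _ n] gram_mat[OF assms])
qed

text \<open>Vanishing on the diagonal is a quadratic condition and cannot be read off from unit
  vectors. Skew-symmetry can, and over the reals it gives the diagonal back because 2 is
  invertible.\<close>

lemma alternating_form_real_extension:
  assumes "alternating_form n \<omega>"
  shows "alternating_form n (real_extension n \<omega>)"
proof -
  let ?w = "real_extension n \<omega>"
  have b: "bilinear_form n \<omega>" using assms by (simp add: alternating_form_iff)
  have "bilinear_form n (\<lambda>x y. - ?w y x)"
    using bilinear_form_real_extension[of n \<omega>] by (simp add: bilinear_form_def)
  moreover have "?w (unit_vec n a) (unit_vec n b) = - ?w (unit_vec n b) (unit_vec n a)" for a b
    using real_extension[OF b unit_vec_carrier unit_vec_carrier, of a b]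
      real_extension[OF b unit_vec_carrier unit_vec_carrier, of b a]
      alternating_form_skew[OF assms unit_vec_carrier unit_vec_carrier, of a b]
    by (simp add: real_vec_unit)
  ultimately have "?w x x = - ?w x x" if "x \<in> carrier_vec n" for x
    using bilinear_form_eqI[OF bilinear_form_real_extension] that by blast
  then have "?w x x = 0" if "x \<in> carrier_vec n" for x
    using that[THEN \<open>\<And>x. x \<in> carrier_vec n \<Longrightarrow> ?w x x = - ?w x x\<close>] by simp
  then show ?thesis by (simp add: alternating_form_iff bilinear_form_real_extension)
qed

text \<open>The determinant of the Gram matrix is the same number over both rings, and over either
  of them it vanishes exactly when there is a nonzero kernel vector.\<close>

lemma real_extension_nondegenerate:
  assumes alt: "alternating_form n \<omega>" and nd: "nondegenerate n \<omega>"
    and x: "x \<in> carrier_vec n" and 0: "\<And>y. y \<in> carrier_vec n \<Longrightarrow> real_extension n \<omega> y x = 0"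
  shows "x = 0\<^sub>v n"
proof -
  let ?W = "gram_mat n \<omega>"
  have b: "bilinear_form n \<omega>" using alt by (simp add: alternating_form_iff)
  have "v = 0\<^sub>v n" if v: "v \<in> carrier_vec n" "?W *\<^sub>v v = 0\<^sub>v n" for v
  proof -
    have "\<omega> v w = 0" if w: "w \<in> carrier_vec n" for w
      using alternating_form_skew[OF alt v(1) w] gram_mat[OF b w v(1)] v(2) w by simp
    then show ?thesis using nd v(1) by (auto simp: nondegenerate_def)
  qed
  then have "det ?W \<noteq> 0"
    using det_0_iff_vec_prod_zero[OF gram_mat_carrier] by blast
  then have "det (real_mat ?W) \<noteq> 0" by simp
  moreover have "real_mat ?W *\<^sub>v x = 0\<^sub>v n"
  proof (rule eq_vecI)
    fix a assume "a < dim_vec (0\<^sub>v n :: real vec)"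
    then show "(real_mat ?W *\<^sub>v x) $ a = 0\<^sub>v n $ a"
      using 0[OF unit_vec_carrier, of a] x
        scalar_prod_left_unit[of "real_mat ?W *\<^sub>v x" n a]
      by (simp add: real_extension_def del: index_mult_mat_vec)
  qed (simp add: gram_mat_def)
  ultimately show ?thesis
    using det_0_iff_vec_prod_zero[of "real_mat ?W" n] x by auto
qed


subsection \<open>The characteristic representation\<close>

lemma GL_int_group: "group (GL_int n)"
proof -
  interpret ring "ring_mat TYPE(int) n ()" by (rule ring_mat)
  show ?thesis by (rule units_group)
qed

lemma GL_int_simps:
  "carrier (GL_int n) = {M \<in> carrier_mat n n. \<exists>N \<in> carrier_mat n n. N * M = 1\<^sub>m n \<and> M * N = 1\<^sub>m n}"
  "monoid.mult (GL_int n) = (*)" "monoid.one (GL_int n) = 1\<^sub>m n"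
  by (auto simp: units_of_def Units_def ring_mat_simps)

lemma smult_one_mat: "1 \<cdot>\<^sub>m M = (M :: 'a::monoid_mult mat)"
  by auto

text \<open>For determinant 1 the adjugate is an integral inverse.\<close>

lemma SL_int_subset: "SL_int n \<subseteq> carrier (GL_int n)"
proof
  fix P :: "int mat" assume "P \<in> SL_int n"
  then show "P \<in> carrier (GL_int n)"
    using adj_mat[of P n] unfolding SL_int_def GL_int_simps
    by (auto simp: smult_one_mat intro!: bexI[of _ "adj_mat P"])
qed

text \<open>As \<open>i\<close> is injective, matrices can be compared after applying
  \<open>i\<close>, where a product becomes iterated conjugation by lifts. Surjectivity of
  \<open>p\<close> provides the lifts, and the image of the inverse of \<open>g\<close> is the
  inverse matrix.\<close>

lemma characteristic_rep_hom:
  assumes "group \<Gamma>" "group G" "short_exact (Z_group n) \<Gamma> G i p"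
  shows "characteristic_rep n \<Gamma> i p \<in> hom G (GL_int n)"
proof -
  interpret \<Gamma>: group \<Gamma> by fact
  interpret G: group G by fact
  let ?\<mu> = "characteristic_rep n \<Gamma> i p"
  have inj: "inj_on i (carrier_vec n)" and ph: "p \<in> hom \<Gamma> G" and surj: "p ` carrier \<Gamma> = carrier G"
    and ker: "i ` carrier_vec n = kernel \<Gamma> G p"
    using assms(3) by (auto simp: short_exact_def mon_def epi_def module_vec_simps)
  interpret p: group_hom \<Gamma> G p by unfold_locales (fact ph)
  have ic: "i v \<in> carrier \<Gamma>" if "v \<in> carrier_vec n" for v
    using ker that by (auto simp: kernel_def)
  note \<mu> = characteristic_rep[OF assms]
  have mult: "?\<mu> (p x \<otimes>\<^bsub>G\<^esub> p y) = ?\<mu> (p x) * ?\<mu> (p y)"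
    if x: "x \<in> carrier \<Gamma>" and y: "y \<in> carrier \<Gamma>" for x y
  proof (rule mat_eq_if_mult_vec_eq)
    have xy: "?\<mu> (p x \<otimes>\<^bsub>G\<^esub> p y) = ?\<mu> (p (x \<otimes>\<^bsub>\<Gamma>\<^esub> y))" using x y by simp
    show "?\<mu> (p x \<otimes>\<^bsub>G\<^esub> p y) \<in> carrier_mat n n"
      unfolding xy by (rule \<mu>(1)) (use x y in simp)
    fix v :: "int vec" assume v: "v \<in> carrier_vec n"
    have "i (?\<mu> (p x) *\<^sub>v (?\<mu> (p y) *\<^sub>v v)) = x \<otimes>\<^bsub>\<Gamma>\<^esub> (y \<otimes>\<^bsub>\<Gamma>\<^esub> i v \<otimes>\<^bsub>\<Gamma>\<^esub> inv\<^bsub>\<Gamma>\<^esub> y) \<otimes>\<^bsub>\<Gamma>\<^esub> inv\<^bsub>\<Gamma>\<^esub> x"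
      using x y v by (simp add: \<mu>)
    also have "\<dots> = i (?\<mu> (p (x \<otimes>\<^bsub>\<Gamma>\<^esub> y)) *\<^sub>v v)"
      using x y v ic[OF v] by (subst \<mu>(2)) (simp_all add: \<Gamma>.m_assoc \<Gamma>.inv_mult_group)
    finally show "?\<mu> (p x \<otimes>\<^bsub>G\<^esub> p y) *\<^sub>v v = ?\<mu> (p x) * ?\<mu> (p y) *\<^sub>v v"
      unfolding xy using x y v \<mu>(1)[of "x \<otimes>\<^bsub>\<Gamma>\<^esub> y"]
      by (intro inj_onD[OF inj]) (simp_all add: \<mu> assoc_mult_mat_vec[of _ n n _ n])
  qed (use x y in \<open>simp add: \<mu>\<close>)
  have one: "?\<mu> (\<one>\<^bsub>G\<^esub>) = 1\<^sub>m n"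
  proof (rule mat_eq_if_mult_vec_eq)
    have 1: "?\<mu> (\<one>\<^bsub>G\<^esub>) = ?\<mu> (p \<one>\<^bsub>\<Gamma>\<^esub>)" by simp
    show c: "?\<mu> (\<one>\<^bsub>G\<^esub>) \<in> carrier_mat n n" unfolding 1 by (rule \<mu>(1)) simp
    fix v :: "int vec" assume v: "v \<in> carrier_vec n"
    have "i (?\<mu> (\<one>\<^bsub>G\<^esub>) *\<^sub>v v) = i v"
      unfolding 1 using v ic[OF v] by (subst \<mu>(2)) simp_all
    then show "?\<mu> (\<one>\<^bsub>G\<^esub>) *\<^sub>v v = 1\<^sub>m n *\<^sub>v v"
      using v c by (intro inj_onD[OF inj]) simp_all
  qed simp
  have \<mu>c: "?\<mu> g \<in> carrier_mat n n" if "g \<in> carrier G" for g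
    using that \<mu>(1) unfolding surj[symmetric] by blast
  have \<mu>m: "?\<mu> (g \<otimes>\<^bsub>G\<^esub> h) = ?\<mu> g * ?\<mu> h" if "g \<in> carrier G" "h \<in> carrier G" for g h
    using that mult unfolding surj[symmetric] by blast
  have "?\<mu> g \<in> carrier (GL_int n)" if g: "g \<in> carrier G" for g
    using \<mu>m[of g "inv\<^bsub>G\<^esub> g"] \<mu>m[of "inv\<^bsub>G\<^esub> g" g] g \<mu>c[OF g] \<mu>c[of "inv\<^bsub>G\<^esub> g"]
    by (auto simp: GL_int_simps one)
  then show ?thesis using \<mu>m by (auto simp: hom_def GL_int_simps(2))
qed

section \<open>Removing the conjugation\<close>

lemma SL_conjugate_symplectic_iff:
  assumes "group G" and \<mu>: "\<mu> \<in> hom G (GL_int n)"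
  shows "(\<exists>\<rho>. symplectic_rep n G \<rho> \<and> SL_conjugate n G \<mu> \<rho>) \<longleftrightarrow> symplectic_rep n G \<mu>"
proof
  interpret GL: group "GL_int n" by (rule GL_int_group)
  have \<mu>G: "\<mu> g \<in> carrier (GL_int n)" if "g \<in> carrier G" for g
    using \<mu> that by (auto simp: hom_def)
  have carrierD: "M \<in> carrier_mat n n" if "M \<in> carrier (GL_int n)" for M
    using that by (simp add: GL_int_simps)
  {
    assume "symplectic_rep n G \<mu>"
    moreover have "SL_conjugate n G \<mu> \<mu>"
      unfolding SL_conjugate_def
    proof (intro bexI ballI)
      fix g assume "g \<in> carrier G"
      then have "\<mu> g \<in> carrier_mat n n" by (intro carrierD \<mu>G)
      then show "\<mu> g = 1\<^sub>m n * \<mu> g * inv\<^bsub>GL_int n\<^esub> 1\<^sub>m n"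
        using GL.inv_one by (simp add: GL_int_simps(3))
    qed (simp add: SL_int_def)
    ultimately show "\<exists>\<rho>. symplectic_rep n G \<rho> \<and> SL_conjugate n G \<mu> \<rho>" by blast
  next
    assume "\<exists>\<rho>. symplectic_rep n G \<rho> \<and> SL_conjugate n G \<mu> \<rho>"
    then obtain \<rho> P \<omega> where P: "P \<in> SL_int n"
      and \<rho>: "\<And>g. g \<in> carrier G \<Longrightarrow> \<rho> g = P * \<mu> g * inv\<^bsub>GL_int n\<^esub> P"
      and alt: "alternating_form n \<omega>" and nd: "nondegenerate n \<omega>"
      and inv: "\<And>g x y. g \<in> carrier G \<Longrightarrow> x \<in> carrier_vec n \<Longrightarrow> y \<in> carrier_vec n \<Longrightarrow>
         \<omega> (\<rho> g *\<^sub>v x) (\<rho> g *\<^sub>v y) = \<omega> x y"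
      unfolding symplectic_rep_def SL_conjugate_def by blast
    define Q where "Q = inv\<^bsub>GL_int n\<^esub> P"
    have PG: "P \<in> carrier (GL_int n)" using P SL_int_subset by blast
    have Pc: "P \<in> carrier_mat n n" and Qc: "Q \<in> carrier_mat n n"
      using PG GL.inv_closed[OF PG] by (simp_all add: Q_def carrierD)
    have PQ: "P * Q = 1\<^sub>m n" and QP: "Q * P = 1\<^sub>m n"
      using GL.r_inv[OF PG] GL.l_inv[OF PG] by (simp_all add: GL_int_simps Q_def)
    have QPv: "Q *\<^sub>v (P *\<^sub>v v) = v" and PQv: "P *\<^sub>v (Q *\<^sub>v v) = v" if "v \<in> carrier_vec n" for v
      using that Pc Qc assoc_mult_mat_vec[OF Pc Qc that] assoc_mult_mat_vec[OF Qc Pc that]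
      by (simp_all add: PQ QP)
    have \<rho>P: "\<rho> g *\<^sub>v (P *\<^sub>v v) = P *\<^sub>v (\<mu> g *\<^sub>v v)" if g: "g \<in> carrier G" and v: "v \<in> carrier_vec n" for g v
      using v Pc Qc carrierD[OF \<mu>G[OF g]]
      by (simp add: \<rho>[OF g] assoc_mult_mat_vec[of _ n n _ n] QPv flip: Q_def)
    \<comment> \<open>The pull-back along \<open>P\<close>: the relation \<open>\<rho>P\<close>
      makes it invariant under \<open>\<mu>\<close>, and it stays non-degenerate because
      \<open>P\<close> is onto the lattice, with inverse \<open>Q\<close>.\<close>
    let ?w = "\<lambda>x y. \<omega> (P *\<^sub>v x) (P *\<^sub>v y)"
    have "alternating_form n ?w"
      using alt bilinear_form_compose[OF _ Pc Pc] Pc by (auto simp: alternating_form_iff)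
    moreover have "nondegenerate n ?w"
      unfolding nondegenerate_def
    proof (intro ballI impI)
      fix v assume v: "v \<in> carrier_vec n" and 0: "\<forall>w\<in>carrier_vec n. \<omega> (P *\<^sub>v v) (P *\<^sub>v w) = 0"
      have "\<omega> (P *\<^sub>v v) w = 0" if "w \<in> carrier_vec n" for w
        using 0[rule_format, of "Q *\<^sub>v w"] that Qc by (simp add: PQv)
      then have "P *\<^sub>v v = 0\<^sub>v n" using nd v Pc by (auto simp: nondegenerate_def)
      then show "v = 0\<^sub>v n" using QPv[OF v] Qc by (auto simp: scalar_prod_def)
    qed
    moreover have "?w (\<mu> g *\<^sub>v x) (\<mu> g *\<^sub>v y) = ?w x y"
      if "g \<in> carrier G" "x \<in> carrier_vec n" "y \<in> carrier_vec n" for g x y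
      using that inv[of g "P *\<^sub>v x" "P *\<^sub>v y"] Pc by (simp add: \<rho>P)
    ultimately show "symplectic_rep n G \<mu>" using \<mu> unfolding symplectic_rep_def by blast
  }
qed

section \<open>From a polarisation to an invariant integral form\<close>

lemma polarisable_imp_symplectic:
  assumes "group G" "finite (carrier G)" and \<mu>: "\<mu> \<in> hom G (GL_int n)"
    and J: "complex_structure n J" and invJ: "rep_invariant G \<mu> J" and pol: "polarisable n J"
  shows "symplectic_rep n G \<mu>"
proof -
  interpret G: group G by fact
  have \<mu>c: "\<mu> g \<in> carrier_mat n n" if "g \<in> carrier G" for g
    using \<mu> that by (auto simp: hom_def GL_int_simps)
  have \<mu>m: "\<mu> (g \<otimes>\<^bsub>G\<^esub> h) = \<mu> g * \<mu> h" if "g \<in> carrier G" "h \<in> carrier G" for g h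
    using \<mu> that by (auto simp: hom_def GL_int_simps)
  have \<mu>1: "\<mu> \<one>\<^bsub>G\<^esub> = 1\<^sub>m n"
    using hom_one[OF \<mu> assms(1) GL_int_group] by (simp add: GL_int_simps)
  define R where "R g = real_mat (\<mu> g)" for g
  have Rc: "R g \<in> carrier_mat n n" if "g \<in> carrier G" for g
    using \<mu>c[OF that] by (simp add: R_def)
  have Rm: "R (g \<otimes>\<^bsub>G\<^esub> h) = R g * R h" if "g \<in> carrier G" "h \<in> carrier G" for g h
    using that of_int_hom.mat_hom_mult[OF \<mu>c \<mu>c] by (simp add: R_def \<mu>m)
  have Jc: "J \<in> carrier_mat n n" using J by (simp add: complex_structure_def)
  obtain \<beta> where alt: "alternating_form n \<beta>"
    and pos: "\<And>x. x \<in> carrier_vec n \<Longrightarrow> x \<noteq> 0\<^sub>v n \<Longrightarrow> \<beta> (J *\<^sub>v x) x > 0"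
    and int: "\<And>x y. x \<in> carrier_vec n \<Longrightarrow> y \<in> carrier_vec n \<Longrightarrow> \<beta> (real_vec x) (real_vec y) \<in> \<int>"
    using pol unfolding polarisable_def by blast
  have b: "bilinear_form n \<beta>" using alt by (simp add: alternating_form_iff)
  define w where "w = average_form G R \<beta>"
  have w: "alternating_form n w"
    unfolding alternating_form_iff
  proof
    show "bilinear_form n w" unfolding w_def by (rule bilinear_form_average[OF b Rc])
    show "\<forall>x\<in>carrier_vec n. w x x = 0"
      using alt Rc by (auto simp: w_def average_form_def alternating_form_iff intro!: sum.neutral)
  qed
  then have bw: "bilinear_form n w" by (simp add: alternating_form_iff)
  have wint: "w (real_vec x) (real_vec y) \<in> \<int>" if x: "x \<in> carrier_vec n" and y: "y \<in> carrier_vec n" for x y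
    unfolding w_def average_form_def
  proof (rule Ints_sum)
    fix g assume g: "g \<in> carrier G"
    show "\<beta> (R g *\<^sub>v real_vec x) (R g *\<^sub>v real_vec y) \<in> \<int>"
      unfolding R_def real_vec_mult[OF \<mu>c[OF g] x] real_vec_mult[OF \<mu>c[OF g] y]
      using \<mu>c[OF g] x y by (intro int) auto
  qed
  have wpos: "w (J *\<^sub>v x) x > 0" if x: "x \<in> carrier_vec n" and x0: "x \<noteq> 0\<^sub>v n" for x
    unfolding w_def average_form_def
  \<comment> \<open>The identity gives a strictly positive summand. The others are nonnegative,
    since \<open>J\<close> commutes with \<open>R g\<close> and each has the shape \<beta>(Jz, z)
    with z the image of \<open>x\<close>.\<close>
  proof (rule sum_pos2[OF assms(2) G.one_closed])
    have "R \<one>\<^bsub>G\<^esub> = 1\<^sub>m n" by (simp add: R_def \<mu>1 of_int_hom.mat_hom_one)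
    then show "0 < \<beta> (R \<one>\<^bsub>G\<^esub> *\<^sub>v (J *\<^sub>v x)) (R \<one>\<^bsub>G\<^esub> *\<^sub>v x)" using pos[OF x x0] x Jc by simp
    fix g assume g: "g \<in> carrier G"
    have "R g *\<^sub>v (J *\<^sub>v x) = (R g * J) *\<^sub>v x" using x Jc Rc[OF g] by simp
    also have "R g * J = J * R g" using invJ g by (simp add: rep_invariant_def R_def)
    also have "(J * R g) *\<^sub>v x = J *\<^sub>v (R g *\<^sub>v x)" using x Jc Rc[OF g] by simp
    finally show "0 \<le> \<beta> (R g *\<^sub>v (J *\<^sub>v x)) (R g *\<^sub>v x)"
      using pos[of "R g *\<^sub>v x"] x Jc Rc[OF g]
      by (cases "R g *\<^sub>v x = 0\<^sub>v n") (simp_all add: bilinear_formD[OF b] less_imp_le)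
  qed
  \<comment> \<open>On lattice vectors \<open>w\<close> is already integral, so the floor merely
    changes the type; the laws for \<open>\<omega>\<close> are checked after embedding into the
    reals.\<close>
  define \<omega> where "\<omega> x y = \<lfloor>w (real_vec x) (real_vec y)\<rfloor>" for x y
  have \<omega>: "real_of_int (\<omega> x y) = w (real_vec x) (real_vec y)"
    if "x \<in> carrier_vec n" "y \<in> carrier_vec n" for x y
    using wint[OF that] by (auto simp: \<omega>_def elim: Ints_cases)
  have "alternating_form n \<omega>"
    unfolding alternating_form_def
  proof (intro conjI ballI allI)
    fix x y z :: "int vec" and c :: int
    assume x: "x \<in> carrier_vec n"
    show "\<omega> x x = 0"
      using x w by (subst of_int_eq_iff[where 'a = real, symmetric]) (simp add: \<omega> alternating_form_iff)
    assume y: "y \<in> carrier_vec n"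
    show "\<omega> (c \<cdot>\<^sub>v x) y = c * \<omega> x y" "\<omega> x (c \<cdot>\<^sub>v y) = c * \<omega> x y"
      using x y by (subst of_int_eq_iff[where 'a = real, symmetric],
          simp add: \<omega> of_int_hom.vec_hom_smult bilinear_formD[OF bw])+
    assume z: "z \<in> carrier_vec n"
    show "\<omega> (x + y) z = \<omega> x z + \<omega> y z" "\<omega> x (y + z) = \<omega> x y + \<omega> x z"
      using x y z by (subst of_int_eq_iff[where 'a = real, symmetric],
          simp add: \<omega> real_vec_add[of _ n] bilinear_formD[OF bw])+
  qed
  moreover have "nondegenerate n \<omega>"
    unfolding nondegenerate_def
  proof (intro ballI impI)
    fix v :: "int vec" assume v: "v \<in> carrier_vec n" and 0: "\<forall>u\<in>carrier_vec n. \<omega> v u = 0"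
    let ?v = "real_vec v"
    have rv: "?v \<in> carrier_vec n" "J *\<^sub>v ?v \<in> carrier_vec n" using v Jc by auto
    \<comment> \<open>The vector \<open>J *\<^sub>v ?v\<close> is in general not integral, so the
      hypothesis reaches it through the unit vectors and linearity.\<close>
    have "w ?v (unit_vec n j) = 0" for j
      using \<omega>[OF v unit_vec_carrier, of j] 0 by (simp add: real_vec_unit)
    then have "w ?v (J *\<^sub>v ?v) = 0"
      using bilinear_form_expansion_right[OF bw rv] by simp
    then have "w (J *\<^sub>v ?v) ?v = 0"
      using alternating_form_skew[OF w rv] by simp
    then have "?v = 0\<^sub>v n" using wpos[OF rv(1)] by force
    then show "v = 0\<^sub>v n" by simp
  qed
  moreover have "\<omega> (\<mu> g *\<^sub>v x) (\<mu> g *\<^sub>v y) = \<omega> x y"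
    if g: "g \<in> carrier G" and x: "x \<in> carrier_vec n" and y: "y \<in> carrier_vec n" for g x y
  proof -
    have "w (R g *\<^sub>v real_vec x) (R g *\<^sub>v real_vec y) = w (real_vec x) (real_vec y)"
      unfolding w_def using x y by (intro average_form_invariant[OF assms(1) g Rc Rm]) auto
    then show ?thesis
      using \<mu>c[OF g] x y by (simp add: \<omega>_def R_def real_vec_mult[of _ n])
  qed
  ultimately show ?thesis using \<mu> unfolding symplectic_rep_def by blast
qed

section \<open>From an invariant integral form to a polarisable complex structure\<close>

lemma symplectic_imp_polarisable:
  assumes "group G" "finite (carrier G)" and sp: "symplectic_rep n G \<mu>"
  shows "\<exists>J. complex_structure n J \<and> rep_invariant G \<mu> J \<and> polarisable n J"
proof -
  interpret G: group G by fact
  have \<mu>: "\<mu> \<in> hom G (GL_int n)" using sp by (simp add: symplectic_rep_def)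
  have \<mu>c: "\<mu> g \<in> carrier_mat n n" if "g \<in> carrier G" for g
    using \<mu> that by (auto simp: hom_def GL_int_simps)
  have \<mu>m: "\<mu> (g \<otimes>\<^bsub>G\<^esub> h) = \<mu> g * \<mu> h" if "g \<in> carrier G" "h \<in> carrier G" for g h
    using \<mu> that by (auto simp: hom_def GL_int_simps)
  have \<mu>1: "\<mu> \<one>\<^bsub>G\<^esub> = 1\<^sub>m n"
    using hom_one[OF \<mu> assms(1) GL_int_group] by (simp add: GL_int_simps)
  define R where "R g = real_mat (\<mu> g)" for g
  have Rc: "R g \<in> carrier_mat n n" if "g \<in> carrier G" for g
    using \<mu>c[OF that] by (simp add: R_def)
  have Rm: "R (g \<otimes>\<^bsub>G\<^esub> h) = R g * R h" if "g \<in> carrier G" "h \<in> carrier G" for g h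
    using that of_int_hom.mat_hom_mult[OF \<mu>c \<mu>c] by (simp add: R_def \<mu>m)
  have R1: "R \<one>\<^bsub>G\<^esub> = 1\<^sub>m n" by (simp add: R_def \<mu>1 of_int_hom.mat_hom_one)
  obtain \<omega> where alt: "alternating_form n \<omega>" and nd: "nondegenerate n \<omega>"
    and inv: "\<And>g x y. g \<in> carrier G \<Longrightarrow> x \<in> carrier_vec n \<Longrightarrow> y \<in> carrier_vec n \<Longrightarrow>
         \<omega> (\<mu> g *\<^sub>v x) (\<mu> g *\<^sub>v y) = \<omega> x y"
    using sp unfolding symplectic_rep_def by blast
  have b: "bilinear_form n \<omega>" using alt by (simp add: alternating_form_iff)
  let ?w = "real_extension n \<omega>"
  have winv: "?w (R g *\<^sub>v x) (R g *\<^sub>v y) = ?w x y"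
    if g: "g \<in> carrier G" and "x \<in> carrier_vec n" "y \<in> carrier_vec n" for g x y
  \<comment> \<open>Invariance is known only on integer vectors, but both sides are bilinear and the
    unit vectors are integral.\<close>
  proof (rule bilinear_form_eqI[OF _ _ _ that(2,3)])
    show "bilinear_form n (\<lambda>x y. ?w (R g *\<^sub>v x) (R g *\<^sub>v y))"
      by (intro bilinear_form_compose bilinear_form_real_extension Rc g)
    fix a c
    have R: "R g *\<^sub>v unit_vec n k = real_vec (\<mu> g *\<^sub>v unit_vec n k)" for k
      using real_vec_mult[OF \<mu>c[OF g] unit_vec_carrier] by (simp add: R_def real_vec_unit)
    show "?w (R g *\<^sub>v unit_vec n a) (R g *\<^sub>v unit_vec n c) = ?w (unit_vec n a) (unit_vec n c)"
      unfolding R using real_extension[OF b] inv[OF g] \<mu>c[OF g]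
      by (metis real_vec_unit square_mat_mult_vec_carrier unit_vec_carrier)
  qed (rule bilinear_form_real_extension)
  let ?ip = "average_form G R (\<lambda>x y. x \<bullet> y)"
  interpret dominating_inner_product n ?ip
  proof
    show "bilinear_form n ?ip"
      by (intro bilinear_form_average bilinear_form_scalar_prod Rc)
    fix x :: "real vec" assume x: "x \<in> carrier_vec n"
    \<comment> \<open>The summand at the identity is \<open>x \<bullet> x\<close> and all others are
      nonnegative, which gives domination.\<close>
    have "0 \<le> z \<bullet> z" for z :: "real vec" by (simp add: scalar_prod_def sum_nonneg)
    then show "x \<bullet> x \<le> ?ip x x"
      using member_le_sum[of "\<one>\<^bsub>G\<^esub>" "carrier G" "\<lambda>g. (R g *\<^sub>v x) \<bullet> (R g *\<^sub>v x)"] x assms(2)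
      by (simp add: average_form_def R1)
    fix y :: "real vec" assume y: "y \<in> carrier_vec n"
    show "?ip x y = ?ip y x"
      unfolding average_form_def using x y Rc
      by (intro sum.cong refl comm_scalar_prod[of _ n]) auto
  qed
  have altw: "alternating_form n ?w" by (rule alternating_form_real_extension[OF alt])
  obtain J where J: "complex_structure n J"
    "\<And>x y. x \<in> carrier_vec n \<Longrightarrow> y \<in> carrier_vec n \<Longrightarrow> ?w (J *\<^sub>v x) (J *\<^sub>v y) = ?w x y"
    "\<And>x. x \<in> carrier_vec n \<Longrightarrow> x \<noteq> 0\<^sub>v n \<Longrightarrow> ?w (J *\<^sub>v x) x > 0"
    and comm: "\<And>M N. M \<in> carrier_mat n n \<Longrightarrow> N \<in> carrier_mat n n \<Longrightarrow> M * N = 1\<^sub>m n \<Longrightarrow>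
       (\<And>x y. x \<in> carrier_vec n \<Longrightarrow> y \<in> carrier_vec n \<Longrightarrow> ?ip (M *\<^sub>v x) (M *\<^sub>v y) = ?ip x y) \<Longrightarrow>
       (\<And>x y. x \<in> carrier_vec n \<Longrightarrow> y \<in> carrier_vec n \<Longrightarrow> ?w (M *\<^sub>v x) (M *\<^sub>v y) = ?w x y) \<Longrightarrow>
       M * J = J * M"
    using compatible_complex_structure[OF altw real_extension_nondegenerate[OF alt nd]] by blast
  have "R g * J = J * R g" if g: "g \<in> carrier G" for g
  proof (rule comm[OF Rc[OF g] Rc[OF G.inv_closed[OF g]]])
    show "R g * R (inv\<^bsub>G\<^esub> g) = 1\<^sub>m n" using g by (simp add: R1 flip: Rm)
  qed (use g winv average_form_invariant[OF assms(1) g Rc Rm] in auto)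
  then have "rep_invariant G \<mu> J" by (simp add: rep_invariant_def R_def)
  moreover have "polarisable n J"
    unfolding polarisable_def
    using altw J real_extension[OF b] by (intro exI[of _ ?w]) auto
  ultimately show ?thesis using J(1) by blast
qed

theorem theorem1p3:
  fixes \<Gamma> :: "('a, 'b) monoid_scheme" and G :: "('c, 'd) monoid_scheme"
    and n :: nat and i :: "int vec \<Rightarrow> 'a" and p :: "'a \<Rightarrow> 'c"
  assumes "group \<Gamma>" and "finitely_generated \<Gamma>" and "virtually_abelian \<Gamma>"
    and "group G" and "finite (carrier G)"
    and "short_exact (Z_group n) \<Gamma> G i p"
  shows "admits_polarisable_complex_structure n \<Gamma> G i p \<longleftrightarrow>
    (\<exists>\<rho>. symplectic_rep n G \<rho> \<and> SL_conjugate n G (characteristic_rep n \<Gamma> i p) \<rho>)"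
proof -
  have hom: "characteristic_rep n \<Gamma> i p \<in> hom G (GL_int n)"
    using assms by (intro characteristic_rep_hom)
  show ?thesis
    unfolding SL_conjugate_symplectic_iff[OF assms(4) hom] admits_polarisable_complex_structure_def
    using polarisable_imp_symplectic[OF assms(4,5) hom] symplectic_imp_polarisable[OF assms(4,5)]
    by blast
qed

end
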